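(* Let $\sigma$ be any fixed signature containing at least two labels. For any $\epsilon>0$, there is an infinite family $G_1,G_2,\ldots$ of labelled downward tree ($\mathsf{DWT}$) queries and an infinite family $H_1,H_2,\ldots$ of labelled downward tree ($\mathsf{DWT}$) instances, all on signature $\sigma$ and with $\|G_i\|+\|H_i\|$ unbounded, such that, for any $i>0$, any DNNF circuit representing the Boolean function $\mathsf{Prov}^{G_i}_{H_i}$ has size at least $2^{\Omega\left((\|G_i\|+\|H_i\|)^{1-\epsilon}\right)}$ (the constant in $\Omega$ being independent of $i$).
   Context: A signature $\sigma$ is a non-empty finite set of labels. A graph over $\sigma$ is $G=(V,E,\lambda)$ with $V$ finite non-empty, $E\subseteq V^2$ (directed edges), $\lambda:E\to\sigma$; its size $\|G\|$ is $|E|$. A homomorphism from $G$ to $H$ is a map $h:V_G\to V_H$ such that for all $(u,v)\in E_G$ we have $(h(u),h(v))\in E_H$ and $\lambda_H((h(u),h(v)))=\lambda_G((u,v))$; write $G\rightsquigarrow H$ if one exists. A downward tree is a rooted unranked tree with all edges directed from parent to child. Provenance: for graphs $G,H$, $\mathsf{Prov}^G_H$ is the Boolean function whose variables are the edges $E_H$ of $H$, mapping a valuation $\nu:E_H\to\{0,1\}$ to $1$ iff $G\rightsquigarrow H_\nu$, where $H_\nu$ is the subgraph of $H$ on the same vertices keeping exactly the edges $e$ with $\nu(e)=1$. A circuit on a set of Boolean variables is a directed acyclic graph of gates (edges are called wires) with a distinguished output gate, where gates are labelled by variables (no inputs), or by $\lor$, $\land$, $\neg$ ($\neg$-gates having exactly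 one input); it computes a Boolean function in the usual way. It is a DNNF if negations are applied only to variable gates and it is decomposable: no $\land$-gate has two distinct inputs $g_1,g_2$ such that some variable labels two variable gates $g_1',g_2'$ with a directed path from $g_1'$ to $g_1$ and from $g_2'$ to $g_2$. The size of a circuit is its number of wires. *)

theory Defs
  imports Complex_Main
begin

section \<open>Labelled graphs, homomorphisms and provenance\<close>

text \<open>The labelling is a total HOL function; only its values on \<open>edges\<close> are meaningful.\<close>

record ('v, 'l) lgraph =
  verts :: "'v set"
  edges :: "('v \<times> 'v) set"
  lab :: "'v \<times> 'v \<Rightarrow> 'l"

definition signature :: "'l set \<Rightarrow> bool" where
  "signature \<sigma> \<longleftrightarrow> finite \<sigma> \<and> \<sigma> \<noteq> {}"

definition graph_over :: "'l set \<Rightarrow> ('v, 'l) lgraph \<Rightarrow> bool" where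
  "graph_over \<sigma> G \<longleftrightarrow>
     finite (verts G) \<and> verts G \<noteq> {} \<and> edges G \<subseteq> verts G \<times> verts G \<and> lab G ` edges G \<subseteq> \<sigma>"

definition gsize :: "('v, 'l) lgraph \<Rightarrow> nat" where
  "gsize G = card (edges G)"

definition hom :: "('v, 'l) lgraph \<Rightarrow> ('w, 'l) lgraph \<Rightarrow> ('v \<Rightarrow> 'w) \<Rightarrow> bool" where
  "hom G H h \<longleftrightarrow>
     h ` verts G \<subseteq> verts H \<and>
     (\<forall>(u, v) \<in> edges G. (h u, h v) \<in> edges H \<and> lab H (h u, h v) = lab G (u, v))"

definition has_hom :: "('v, 'l) lgraph \<Rightarrow> ('w, 'l) lgraph \<Rightarrow> bool" (infix "\<leadsto>" 50) where
  "G \<leadsto> H \<longleftrightarrow> (\<exists>h. hom G H h)"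

text \<open>A root without parent, exactly one parent for every other vertex, and every vertex a
  descendant of the root.\<close>

definition downward_tree :: "'l set \<Rightarrow> ('v, 'l) lgraph \<Rightarrow> bool" where
  "downward_tree \<sigma> G \<longleftrightarrow>
     graph_over \<sigma> G \<and>
     (\<exists>r \<in> verts G.
        (\<forall>u. (u, r) \<notin> edges G) \<and>
        (\<forall>v \<in> verts G - {r}. \<exists>!u. (u, v) \<in> edges G) \<and>
        (\<forall>v \<in> verts G. (r, v) \<in> (edges G)\<^sup>*))"

definition restrict_edges :: "('w, 'l) lgraph \<Rightarrow> ('w \<times> 'w \<Rightarrow> bool) \<Rightarrow> ('w, 'l) lgraph" where
  "restrict_edges H \<nu> = H\<lparr>edges := {e \<in> edges H. \<nu> e}\<rparr>"

text \<open>A Boolean function on a set of variables \<open>X\<close> is rendered as a predicate on total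
  valuations that only depends on their values on \<open>X\<close>; here \<open>X = edges H\<close>.\<close>

definition Prov :: "('v, 'l) lgraph \<Rightarrow> ('w, 'l) lgraph \<Rightarrow> ('w \<times> 'w \<Rightarrow> bool) \<Rightarrow> bool" where
  "Prov G H \<nu> \<longleftrightarrow> G \<leadsto> restrict_edges H \<nu>"

lemma Prov_cong:
  assumes "\<And>e. e \<in> edges H \<Longrightarrow> \<nu> e = \<nu>' e"
  shows "Prov G H \<nu> = Prov G H \<nu>'"
proof -
  have "{e \<in> edges H. \<nu> e} = {e \<in> edges H. \<nu>' e}"
    using assms by auto
  then show ?thesis
    by (simp add: Prov_def restrict_edges_def)
qed


section \<open>Boolean circuits\<close>

datatype 'x gate_label = VarGate 'x | OrGate | AndGate | NotGate

text \<open>A wire \<open>(g', g)\<close> makes \<open>g'\<close> an input of \<open>g\<close>.\<close>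

record ('g, 'x) circuit =
  gates :: "'g set"
  wires :: "('g \<times> 'g) set"
  glabel :: "'g \<Rightarrow> 'x gate_label"
  outgate :: 'g

text \<open>Fan-in of \<open>OrGate\<close> and \<open>AndGate\<close> gates is arbitrary; with no inputs they are the constants
  false and true.\<close>

definition circuit_on :: "'x set \<Rightarrow> ('g, 'x) circuit \<Rightarrow> bool" where
  "circuit_on X C \<longleftrightarrow>
     finite (gates C) \<and> wires C \<subseteq> gates C \<times> gates C \<and> acyclic (wires C) \<and>
     outgate C \<in> gates C \<and>
     (\<forall>g \<in> gates C.
        (case glabel C g of
           VarGate x \<Rightarrow> x \<in> X \<and> (\<forall>g'. (g', g) \<notin> wires C)
         | NotGate \<Rightarrow> (\<exists>!g'. (g', g) \<in> wires C)
         | _ \<Rightarrow> True))"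

definition circuit_size :: "('g, 'x) circuit \<Rightarrow> nat" where
  "circuit_size C = card (wires C)"

text \<open>Evaluation by recursion along the wires; see \<open>gate_value_unfold\<close> for the resulting
  equation.\<close>

definition gate_value :: "('g, 'x) circuit \<Rightarrow> ('x \<Rightarrow> bool) \<Rightarrow> 'g \<Rightarrow> bool" where
  "gate_value C \<nu> = wfrec (wires C) (\<lambda>val g.
     case glabel C g of
       VarGate x \<Rightarrow> \<nu> x
     | OrGate \<Rightarrow> (\<exists>g'. (g', g) \<in> wires C \<and> val g')
     | AndGate \<Rightarrow> (\<forall>g'. (g', g) \<in> wires C \<longrightarrow> val g')
     | NotGate \<Rightarrow> (\<exists>g'. (g', g) \<in> wires C \<and> \<not> val g'))"

lemma circuit_on_wf:
  assumes "circuit_on X C"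
  shows "wf (wires C)"
proof (rule finite_acyclic_wf)
  show "finite (wires C)"
    using assms unfolding circuit_on_def by (meson finite_SigmaI finite_subset)
  show "acyclic (wires C)"
    using assms unfolding circuit_on_def by blast
qed

lemma gate_value_unfold:
  assumes "circuit_on X C"
  shows "gate_value C \<nu> g =
    (case glabel C g of
       VarGate x \<Rightarrow> \<nu> x
     | OrGate \<Rightarrow> (\<exists>g'. (g', g) \<in> wires C \<and> gate_value C \<nu> g')
     | AndGate \<Rightarrow> (\<forall>g'. (g', g) \<in> wires C \<longrightarrow> gate_value C \<nu> g')
     | NotGate \<Rightarrow> (\<exists>g'. (g', g) \<in> wires C \<and> \<not> gate_value C \<nu> g'))"
  by (subst gate_value_def, subst wfrec[OF circuit_on_wf[OF assms]])
    (auto simp: gate_value_def[symmetric] cut_apply split: gate_label.splits)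

definition represents :: "('g, 'x) circuit \<Rightarrow> (('x \<Rightarrow> bool) \<Rightarrow> bool) \<Rightarrow> bool" where
  "represents C f \<longleftrightarrow> (\<forall>\<nu>. gate_value C \<nu> (outgate C) = f \<nu>)"

definition decomposable :: "('g, 'x) circuit \<Rightarrow> bool" where
  "decomposable C \<longleftrightarrow>
     \<not> (\<exists>g \<in> gates C. glabel C g = AndGate \<and>
          (\<exists>g1 g2. (g1, g) \<in> wires C \<and> (g2, g) \<in> wires C \<and> g1 \<noteq> g2 \<and>
             (\<exists>x. \<exists>g1' \<in> gates C. \<exists>g2' \<in> gates C.
                glabel C g1' = VarGate x \<and> glabel C g2' = VarGate x \<and>
                (g1', g1) \<in> (wires C)\<^sup>* \<and> (g2', g2) \<in> (wires C)\<^sup>*)))"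

definition DNNF_on :: "'x set \<Rightarrow> ('g, 'x) circuit \<Rightarrow> bool" where
  "DNNF_on X C \<longleftrightarrow>
     circuit_on X C \<and>
     (\<forall>g g'. (g', g) \<in> wires C \<and> glabel C g = NotGate \<longrightarrow> (\<exists>x. glabel C g' = VarGate x)) \<and>
     decomposable C"

end

theory Submission
  imports Defs
begin

text \<open>The hard function is a monotone 2-CNF whose variables are the vertices of the circulant graph on
  \<open>\<int>/m\<^sup>k\<close> with steps \<open>1, m, \<dots>, m\<^sup>k\<^sup>-\<^sup>1\<close>, with one clause per edge. Encoding clauses as binary
  words turns it into a provenance function of two trees of total size \<open>O(m\<^sup>k\<^sup>+\<^sup>1)\<close>, once the edges that
  are not variables are kept. A DNNF covers the models by as many rectangles as it has wires, each with
  respect to a balanced partition of the variables. A balanced partition cuts \<open>\<Omega>(m\<^sup>k\<^sup>-\<^sup>1)\<close> disjoint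
  clauses, and every rectangle of models must satisfy one fixed end of each of them; as the degree is
  bounded, only an exponentially small fraction of suitably random models does so. Hence the
  size is \<open>2\<close> to the power \<open>\<Omega>(m\<^sup>k\<^sup>-\<^sup>1)\<close>, and \<open>k \<ge> 2 / \<epsilon>\<close> suffices.\<close>

section \<open>Rectangle covers from DNNF circuits\<close>

definition gate_vars :: "('g, 'x) circuit \<Rightarrow> 'g \<Rightarrow> 'x set" where
  "gate_vars C g = {x. \<exists>g' \<in> gates C. glabel C g' = VarGate x \<and> (g', g) \<in> (wires C)\<^sup>*}"

lemma gate_vars_wire: "(h, g) \<in> wires C \<Longrightarrow> gate_vars C h \<subseteq> gate_vars C g"
  unfolding gate_vars_def by (blast intro: rtrancl_into_rtrancl)

lemma gate_vars_inner:
  assumes "\<And>x. glabel C g \<noteq> VarGate x"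
  shows "gate_vars C g = (\<Union>h \<in> {h. (h, g) \<in> wires C}. gate_vars C h)"
proof
  show "gate_vars C g \<subseteq> (\<Union>h \<in> {h. (h, g) \<in> wires C}. gate_vars C h)"
  proof
    fix x
    assume "x \<in> gate_vars C g"
    then obtain g' where g': "g' \<in> gates C" "glabel C g' = VarGate x" "(g', g) \<in> (wires C)\<^sup>*"
      unfolding gate_vars_def by blast
    with assms have "g' \<noteq> g" by auto
    with g'(3) obtain h where "(g', h) \<in> (wires C)\<^sup>*" "(h, g) \<in> wires C"
      by (meson rtranclE)
    with g' show "x \<in> (\<Union>h \<in> {h. (h, g) \<in> wires C}. gate_vars C h)"
      unfolding gate_vars_def by blast
  qed
qed (use gate_vars_wire in fast)

lemma gate_vars_VarGate:
  assumes "circuit_on X C" "g \<in> gates C" "glabel C g = VarGate x"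
  shows "gate_vars C g = {x}"
proof -
  have "\<nexists>h. (h, g) \<in> wires C"
    using assms unfolding circuit_on_def by fastforce
  then have "(g', g) \<in> (wires C)\<^sup>* \<longleftrightarrow> g' = g" for g'
    by (metis rtrancl.rtrancl_refl rtranclE)
  with assms(2,3) show ?thesis
    unfolding gate_vars_def by auto
qed

lemma gate_value_cong:
  assumes C: "circuit_on X C"
  shows "g \<in> gates C \<Longrightarrow> (\<And>x. x \<in> gate_vars C g \<Longrightarrow> \<nu> x = \<nu>' x) \<Longrightarrow>
    gate_value C \<nu> g = gate_value C \<nu>' g"
proof (induction g rule: wf_induct_rule[OF circuit_on_wf[OF C]])
  case (1 g)
  have IH: "gate_value C \<nu> h = gate_value C \<nu>' h" if "(h, g) \<in> wires C" for h
  proof (rule "1.IH"[OF that])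
    show "h \<in> gates C" using that C unfolding circuit_on_def by blast
    show "\<nu> x = \<nu>' x" if "x \<in> gate_vars C h" for x
      using that gate_vars_wire[OF \<open>(h, g) \<in> wires C\<close>] "1.prems"(2) by blast
  qed
  show ?case
  proof (cases "glabel C g")
    case (VarGate x)
    then show ?thesis
      using "1.prems" gate_vars_VarGate[OF C]
      by (simp add: gate_value_unfold[OF C])
  qed (use IH in \<open>auto simp: gate_value_unfold[OF C, of _ g]\<close>)
qed

text \<open>A gate is active if making it true forces the output to be true, along some path on which
  all siblings at and-gates are already true.\<close>

inductive active :: "('g, 'x) circuit \<Rightarrow> ('x \<Rightarrow> bool) \<Rightarrow> 'g \<Rightarrow> bool" for C \<nu> where
  base: "active C \<nu> (outgate C)"
| or_input: "active C \<nu> g \<Longrightarrow> glabel C g = OrGate \<Longrightarrow> (h, g) \<in> wires C \<Longrightarrow> active C \<nu> h"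
| and_input: "active C \<nu> g \<Longrightarrow> glabel C g = AndGate \<Longrightarrow> (h, g) \<in> wires C \<Longrightarrow>
    (\<And>h'. (h', g) \<in> wires C \<Longrightarrow> h' \<noteq> h \<Longrightarrow> gate_value C \<nu> h') \<Longrightarrow> active C \<nu> h"

lemma active_in_gates:
  assumes "circuit_on X C" "active C \<nu> g"
  shows "g \<in> gates C"
  using assms(2) by cases (use assms(1) in \<open>auto simp: circuit_on_def\<close>)

lemma active_output:
  assumes C: "circuit_on X C"
  shows "active C \<nu> g \<Longrightarrow> gate_value C \<nu> g \<Longrightarrow> gate_value C \<nu> (outgate C)"
proof (induction rule: active.induct)
  case (or_input g h)
  then have "gate_value C \<nu> g"
    by (subst gate_value_unfold[OF C]) auto
  then show ?case by (rule or_input.IH)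
next
  case (and_input g h)
  then have "gate_value C \<nu> g"
    by (subst gate_value_unfold[OF C]) auto
  then show ?case by (rule and_input.IH)
qed

lemma decomposable_disjoint:
  assumes "decomposable C" "g \<in> gates C" "glabel C g = AndGate"
    "(h, g) \<in> wires C" "(h', g) \<in> wires C" "h \<noteq> h'"
  shows "gate_vars C h \<inter> gate_vars C h' = {}"
  using assms unfolding decomposable_def gate_vars_def by blast

text \<open>Activity rests on siblings at and-gates along a path to the output. By decomposability
  they share no variable with the input on the path, hence none with
  \<open>gate_vars C g\<close>.\<close>

lemma active_cong:
  assumes C: "circuit_on X C" and D: "decomposable C"
  shows "active C \<nu> g \<Longrightarrow> (\<And>x. x \<notin> gate_vars C g \<Longrightarrow> \<nu> x = \<nu>' x) \<Longrightarrow> active C \<nu>' g"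
proof (induction rule: active.induct)
  case base
  show ?case by (rule active.base)
next
  case (or_input g h)
  have "active C \<nu>' g"
    using or_input.IH or_input.prems gate_vars_wire[OF or_input.hyps(3)] by blast
  then show ?case using or_input.hyps by (metis active.or_input)
next
  case (and_input g h)
  have g: "g \<in> gates C"
    using active_in_gates[OF C and_input.hyps(1)] .
  have "active C \<nu>' g"
    using and_input.IH and_input.prems gate_vars_wire[OF and_input.hyps(3)] by blast
  moreover have "gate_value C \<nu>' h'" if h': "(h', g) \<in> wires C" "h' \<noteq> h" for h'
  proof -
    have "gate_value C \<nu> h' = gate_value C \<nu>' h'"
    proof (rule gate_value_cong[OF C])
      show "h' \<in> gates C" using h'(1) C unfolding circuit_on_def by blast
      show "\<nu> x = \<nu>' x" if "x \<in> gate_vars C h'" for x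
        using decomposable_disjoint[OF D g and_input.hyps(2) h'(1) and_input.hyps(3) h'(2)]
          that and_input.prems by blast
    qed
    then show ?thesis using and_input.hyps(4) h' by blast
  qed
  ultimately show ?case using and_input.hyps by (metis active.and_input)
qed

text \<open>Uniting the members one by one adds fewer than \<open>t\<close> elements each time, so
  the cardinality cannot jump over the range from \<open>t\<close> to \<open>2 * t\<close>.\<close>

lemma balanced_subfamily:
  assumes "finite K" "\<And>h. h \<in> K \<Longrightarrow> card (F h) < t" "t \<le> card (\<Union>h\<in>K. F h)" "t > 0"
  shows "\<exists>S \<subseteq> K. t \<le> card (\<Union>h\<in>S. F h) \<and> card (\<Union>h\<in>S. F h) < 2 * t"
  using assms
proof (induction K rule: finite_induct)
  case (insert h K)
  show ?case
  proof (cases "t \<le> card (\<Union>h\<in>K. F h)")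
    case True
    with insert obtain S where "S \<subseteq> K" "t \<le> card (\<Union>h\<in>S. F h)" "card (\<Union>h\<in>S. F h) < 2 * t"
      by auto
    then show ?thesis by blast
  next
    case False
    have "card (\<Union>h\<in>insert h K. F h) \<le> card (F h) + card (\<Union>h\<in>K. F h)"
      using card_Un_le by auto
    also have "\<dots> < 2 * t"
      using False insert.prems(1)[of h] by simp
    finally show ?thesis using insert.prems(2) by blast
  qed
qed simp

definition mix :: "'x set \<Rightarrow> ('x \<Rightarrow> bool) \<Rightarrow> ('x \<Rightarrow> bool) \<Rightarrow> 'x \<Rightarrow> bool" where
  "mix Y \<nu> \<mu> x = (if x \<in> Y then \<nu> x else \<mu> x)"

text \<open>An active true \<open>g\<close> already forces the output. At an or-gate
  \<open>h\<close> records which input is true; at an and-gate any input wire serves. Indexing by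
  wires bounds the number of rectangles by the circuit size.\<close>

definition wire_models :: "('g, 'x) circuit \<Rightarrow> 'g \<times> 'g \<Rightarrow> ('x \<Rightarrow> bool) set" where
  "wire_models C = (\<lambda>(h, g). {\<nu>. active C \<nu> g \<and> gate_value C \<nu> g \<and> gate_value C \<nu> h})"

text \<open>Descend from the output through true gates and stop at the last one that still sees at least
  \<open>t\<close> variables of \<open>U\<close>.\<close>

theorem DNNF_balanced_rectangle_cover:
  assumes DNNF: "DNNF_on X C" and "finite U" and t: "2 \<le> t" "t \<le> card (gate_vars C (outgate C) \<inter> U)"
    and true: "gate_value C \<nu> (outgate C)"
  shows "\<exists>e \<in> wires C. \<nu> \<in> wire_models C e \<and>
    (\<exists>Y. t \<le> card (Y \<inter> U) \<and> card (Y \<inter> U) < 2 * t \<and>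
      (\<forall>\<nu>1 \<in> wire_models C e. \<forall>\<nu>2 \<in> wire_models C e. gate_value C (mix Y \<nu>1 \<nu>2) (outgate C)))"
proof -
  have C: "circuit_on X C" and D: "decomposable C"
    using DNNF by (simp_all add: DNNF_on_def)
  have neg: "\<exists>x. glabel C h = VarGate x" if "(h, g) \<in> wires C" "glabel C g = NotGate" for g h
    using DNNF that unfolding DNNF_on_def by blast
  have wg: "h \<in> gates C \<and> g \<in> gates C" if "(h, g) \<in> wires C" for h g
    using that C unfolding circuit_on_def by blast
  define heavy where "heavy = {g. active C \<nu> g \<and> gate_value C \<nu> g \<and> t \<le> card (gate_vars C g \<inter> U)}"
  have "outgate C \<in> heavy"
    using true t by (simp add: active.base heavy_def)
  then obtain g where "g \<in> heavy" and "\<And>h. (h, g) \<in> wires C \<Longrightarrow> h \<notin> heavy"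
    by (rule wfE_min[OF circuit_on_wf[OF C]]) iprover
  then have g: "active C \<nu> g \<and> gate_value C \<nu> g \<and> t \<le> card (gate_vars C g \<inter> U)"
    and min: "\<And>h. (h, g) \<in> wires C \<Longrightarrow> active C \<nu> h \<Longrightarrow> gate_value C \<nu> h \<Longrightarrow>
      card (gate_vars C h \<inter> U) < t"
    by (force simp: heavy_def)+
  have gg: "g \<in> gates C"
    using active_in_gates[OF C] g by blast
  have active_mix: "active C (mix Y \<nu>1 \<nu>2) g" if "active C \<nu>2 g" "Y \<subseteq> gate_vars C g" for Y \<nu>1 \<nu>2
    by (rule active_cong[OF C D that(1)]) (use that(2) in \<open>auto simp: mix_def\<close>)
  have finU: "finite (A \<inter> U)" for A
    using \<open>finite U\<close> by blast
  show ?thesis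
  proof (cases "glabel C g")
    \<comment> \<open>A gate over a single variable is too light for \<open>2 \<le> t\<close>; the
      same excludes negated variables.\<close>
    case (VarGate x)
    have "card (gate_vars C g \<inter> U) \<le> card {x}"
      using gate_vars_VarGate[OF C gg VarGate] by (intro card_mono) auto
    with g t(1) show ?thesis by simp
  next
    case NotGate
    have "case glabel C g of VarGate x \<Rightarrow> x \<in> X \<and> (\<forall>g'. (g', g) \<notin> wires C)
        | NotGate \<Rightarrow> \<exists>!g'. (g', g) \<in> wires C | _ \<Rightarrow> True"
      using C gg by (simp add: circuit_on_def)
    with NotGate have "\<exists>!h. (h, g) \<in> wires C"
      by simp
    then obtain h where h: "(h, g) \<in> wires C" and "\<And>h'. (h', g) \<in> wires C \<Longrightarrow> h' = h"
      by blast
    then have K: "{h. (h, g) \<in> wires C} = {h}" by blast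
    obtain x where "glabel C h = VarGate x"
      using neg[OF h NotGate] by blast
    then have "gate_vars C g = {x}"
      using gate_vars_inner[of C g] gate_vars_VarGate[OF C] K wg[OF h] NotGate by auto
    then have "card (gate_vars C g \<inter> U) \<le> card {x}"
      by (intro card_mono) auto
    with g t(1) show ?thesis by simp
  next
    case OrGate
    with g obtain h where h: "(h, g) \<in> wires C" "gate_value C \<nu> h"
      by (auto simp: gate_value_unfold[OF C, of _ g])
    have "active C \<nu> h"
      using g OrGate h(1) by (metis active.or_input)
    with h min have "card (gate_vars C h \<inter> U) \<le> t"
      by (simp add: less_imp_le)
    \<comment> \<open>\<open>h\<close> is light by the choice of \<open>g\<close>, so its variables
      are padded inside \<open>gate_vars C g\<close> until exactly \<open>t\<close> of them lie in
      \<open>U\<close>.\<close>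
    then obtain T where T: "gate_vars C h \<inter> U \<subseteq> T" "T \<subseteq> gate_vars C g \<inter> U" "card T = t"
      using exists_subset_between[of "gate_vars C h \<inter> U" t "gate_vars C g \<inter> U"]
        g finU gate_vars_wire[OF h(1)] by blast
    define Y where "Y = gate_vars C h \<union> T"
    have "Y \<inter> U = T" and Y: "Y \<subseteq> gate_vars C g"
      using T gate_vars_wire[OF h(1)] unfolding Y_def by auto
    moreover have "gate_value C (mix Y \<nu>1 \<nu>2) (outgate C)"
      if "\<nu>1 \<in> wire_models C (h, g)" "\<nu>2 \<in> wire_models C (h, g)" for \<nu>1 \<nu>2
    proof -
      \<comment> \<open>\<open>h\<close> reads only variables in \<open>Y\<close>, as under
        \<open>\<nu>1\<close>; activity of \<open>g\<close> depends only on variables outside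
        \<open>gate_vars C g\<close>, where the mix agrees with \<open>\<nu>2\<close>.\<close>
      have "gate_value C \<nu>1 h = gate_value C (mix Y \<nu>1 \<nu>2) h"
        by (rule gate_value_cong[OF C]) (use wg[OF h(1)] in \<open>auto simp: mix_def Y_def\<close>)
      then have "gate_value C (mix Y \<nu>1 \<nu>2) g"
        using that h(1) OrGate by (subst gate_value_unfold[OF C]) (auto simp: wire_models_def)
      with active_mix[OF _ Y] that show ?thesis
        by (intro active_output[OF C, of _ g]) (auto simp: wire_models_def)
    qed
    ultimately show ?thesis
      using T(3) t(1) g h
      by (intro bexI[of _ "(h, g)"] conjI exI[of _ Y]) (auto simp: wire_models_def)
  next
    case AndGate
    define K where "K = {h. (h, g) \<in> wires C}"
    have true_K: "gate_value C \<mu> h" if "gate_value C \<mu> g" "h \<in> K" for \<mu> h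
      using that AndGate by (simp add: gate_value_unfold[OF C, of _ g] K_def)
    have "finite K"
      using C wg unfolding circuit_on_def K_def by (auto intro: finite_subset)
    moreover have "card (gate_vars C h \<inter> U) < t" if "h \<in> K" for h
    proof -
      \<comment> \<open>All inputs of the true and-gate are true, so each of them is active and, by
        the choice of \<open>g\<close>, light.\<close>
      have "active C \<nu> h"
        by (rule active.and_input[of C \<nu> g]) (use g AndGate that true_K in \<open>auto simp: K_def\<close>)
      then show ?thesis
        using min[of h] that g true_K[of \<nu> h] unfolding K_def by simp
    qed
    moreover have vars: "gate_vars C g = (\<Union>h\<in>K. gate_vars C h)"
      using gate_vars_inner[of C g] AndGate unfolding K_def by simp
    then have "(\<Union>h\<in>K. gate_vars C h \<inter> U) = gate_vars C g \<inter> U"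
      by blast
    ultimately obtain S where S: "S \<subseteq> K" "t \<le> card (\<Union>h\<in>S. gate_vars C h \<inter> U)"
      "card (\<Union>h\<in>S. gate_vars C h \<inter> U) < 2 * t"
      using balanced_subfamily[of K "\<lambda>h. gate_vars C h \<inter> U" t] g t(1) by auto
    define Y where "Y = (\<Union>h\<in>S. gate_vars C h)"
    have YU: "Y \<inter> U = (\<Union>h\<in>S. gate_vars C h \<inter> U)" and Y: "Y \<subseteq> gate_vars C g"
      using S(1) vars unfolding Y_def by auto
    have "S \<noteq> {}"
      using S(2) t(1) by auto
    then obtain h where h: "h \<in> K"
      using S(1) by blast
    have "gate_value C (mix Y \<nu>1 \<nu>2) (outgate C)"
      if "\<nu>1 \<in> wire_models C (h, g)" "\<nu>2 \<in> wire_models C (h, g)" for \<nu>1 \<nu>2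
    proof -
      \<comment> \<open>By decomposability each input lies wholly on one side: those in
        \<open>S\<close> read \<open>\<nu>1\<close>, the others are disjoint from \<open>Y\<close>
        and read \<open>\<nu>2\<close>.\<close>
      have "gate_value C (mix Y \<nu>1 \<nu>2) h'" if h': "h' \<in> K" for h'
      proof (cases "h' \<in> S")
        case True
        have "gate_value C \<nu>1 h' = gate_value C (mix Y \<nu>1 \<nu>2) h'"
          by (rule gate_value_cong[OF C]) (use wg h' True in \<open>auto simp: mix_def Y_def K_def\<close>)
        with true_K[OF _ h'] \<open>\<nu>1 \<in> wire_models C (h, g)\<close> show ?thesis
          by (simp add: wire_models_def)
      next
        case False
        have "gate_vars C h' \<inter> Y = {}"
          unfolding Y_def
          using decomposable_disjoint[OF D gg AndGate] h' False S(1) unfolding K_def by blast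
        then have "gate_value C \<nu>2 h' = gate_value C (mix Y \<nu>1 \<nu>2) h'"
          by (intro gate_value_cong[OF C]) (use wg h' in \<open>auto simp: mix_def K_def\<close>)
        with true_K[OF _ h'] \<open>\<nu>2 \<in> wire_models C (h, g)\<close> show ?thesis
          by (simp add: wire_models_def)
      qed
      then have "gate_value C (mix Y \<nu>1 \<nu>2) g"
        using AndGate by (subst gate_value_unfold[OF C]) (auto simp: K_def)
      with active_mix[OF _ Y] that show ?thesis
        by (intro active_output[OF C, of _ g]) (auto simp: wire_models_def)
    qed
    then show ?thesis
      using S YU g h true_K[of \<nu> h]
      by (intro bexI[of _ "(h, g)"] conjI exI[of _ Y] ballI) (auto simp: wire_models_def K_def)
  qed
qed

section \<open>Random independent sets\<close>

text \<open>A uniformly random \<open>S\<close> meets \<open>N z\<close> in \<open>{z}\<close> alone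
  with probability at least \<open>1 / 2 ^ d\<close>. These events are independent for disjoint
  neighbourhoods, and a greedy choice, each time discarding at most \<open>d\<^sup>2\<close> points,
  finds \<open>r\<close> such \<open>z\<close>.\<close>

lemma card_no_isolated_bound:
  fixes N :: "'a \<Rightarrow> 'a set"
  assumes "finite X" and "d > 0"
    and N: "\<And>v. v \<in> X \<Longrightarrow> v \<in> N v \<and> N v \<subseteq> X \<and> card (N v) \<le> d"
    and sym: "\<And>u v. u \<in> X \<Longrightarrow> v \<in> X \<Longrightarrow> u \<in> N v \<Longrightarrow> v \<in> N u"
  shows "Z \<subseteq> X \<Longrightarrow> r * d\<^sup>2 \<le> card Z \<Longrightarrow>
    real (card {S. S \<subseteq> X \<and> (\<forall>z\<in>Z. S \<inter> N z \<noteq> {z})}) \<le> 2 ^ card X * (1 - 1 / 2 ^ d) ^ r"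
proof (induction r arbitrary: Z)
  case 0
  have "card {S. S \<subseteq> X \<and> (\<forall>z\<in>Z. S \<inter> N z \<noteq> {z})} \<le> card (Pow X)"
    using \<open>finite X\<close> by (intro card_mono) auto
  then show ?case
    by (simp add: card_Pow \<open>finite X\<close>)
next
  case (Suc r)
  show ?case
  proof -
    have "Z \<noteq> {}"
      using Suc.prems(2) \<open>d > 0\<close> by auto
    then obtain z where z: "z \<in> Z" "z \<in> X" using Suc.prems(1) by blast
    define B where "B = (\<Union>w \<in> N z. N w)"
    have fin: "finite (N v)" if "v \<in> X" for v
      using N[OF that] \<open>finite X\<close> finite_subset by blast
    have "card B \<le> (\<Sum>w\<in>N z. card (N w))"
      unfolding B_def by (rule card_UN_le[OF fin[OF z(2)]])
    also have "\<dots> \<le> card (N z) * d"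
      using N z(2) by (intro order.trans[OF sum_bounded_above[of _ _ d]]) auto
    also have "\<dots> \<le> d\<^sup>2"
      using N[OF z(2)] by (simp add: power2_eq_square)
    finally have cB: "card B \<le> d\<^sup>2" .
    have finB: "finite B"
      unfolding B_def using fin N[OF z(2)] z(2) by blast
    define E where "E = {S. S \<subseteq> X \<and> (\<forall>v\<in>Z - B. S \<inter> N v \<noteq> {v})}"
    define P where "P = {S \<in> E. S \<inter> N z = {z}}"
    have finE: "finite E"
      unfolding E_def using \<open>finite X\<close> by auto
    have "r * d\<^sup>2 \<le> card (Z - B)"
      using Suc.prems(2) cB diff_card_le_card_Diff[OF finB, of Z] by simp
    then have IH: "real (card E) \<le> 2 ^ card X * (1 - 1 / 2 ^ d) ^ r"
      unfolding E_def using Suc.prems(1) by (intro Suc.IH) auto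
    have disj: "N v \<inter> N z = {}" if "v \<in> Z - B" for v
    proof -
      have "w \<notin> N z" if "w \<in> N v" for w
      proof
        assume "w \<in> N z"
        moreover have "v \<in> N w"
          using sym[of w v] \<open>w \<in> N v\<close> \<open>v \<in> Z - B\<close> Suc.prems(1) N[of v] by blast
        ultimately show False
          using \<open>v \<in> Z - B\<close> unfolding B_def by blast
      qed
      then show ?thesis by blast
    qed
    \<comment> \<open>The conditions defining \<open>E\<close> ignore \<open>N z\<close>, so the
      trace of \<open>S\<close> there may be replaced by \<open>{z}\<close>, which lands in
      \<open>P\<close>. Image and old trace recover \<open>S\<close>, so \<open>P\<close> is at
      least a \<open>1 / 2 ^ d\<close> fraction of \<open>E\<close>.\<close>
    have "card E \<le> card (P \<times> Pow (N z))"
    proof (rule card_inj_on_le)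
      show "inj_on (\<lambda>S. (S - N z \<union> {z}, S \<inter> N z)) E"
      proof (rule inj_onI)
        fix S T
        assume *: "(S - N z \<union> {z}, S \<inter> N z) = (T - N z \<union> {z}, T \<inter> N z)"
        have "R = (R - N z \<union> {z}) - N z \<union> (R \<inter> N z)" for R
          using N[OF z(2)] by blast
        with * show "S = T" by (metis prod.inject)
      qed
      show "(\<lambda>S. (S - N z \<union> {z}, S \<inter> N z)) ` E \<subseteq> P \<times> Pow (N z)"
      proof clarsimp
        fix S
        assume S: "S \<in> E"
        have "insert z (S - N z) \<inter> N v = S \<inter> N v" if "v \<in> Z - B" for v
          using disj[OF that] N[OF z(2)] by blast
        then show "insert z (S - N z) \<in> P"
          using S N[OF z(2)] z(2) unfolding P_def E_def by auto
      qed
      show "finite (P \<times> Pow (N z))"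
        using finE fin[OF z(2)] unfolding P_def by simp
    qed
    also have "\<dots> \<le> card P * 2 ^ d"
      using N[OF z(2)] fin[OF z(2)] by (simp add: card_cartesian_product card_Pow)
    finally have "real (card E) \<le> real (card P * 2 ^ d)"
      by (rule of_nat_mono)
    then have cP: "real (card E) / 2 ^ d \<le> real (card P)"
      by (simp add: field_simps)
    have "card {S. S \<subseteq> X \<and> (\<forall>z\<in>Z. S \<inter> N z \<noteq> {z})} \<le> card (E - P)"
      using finE z(1) unfolding E_def P_def by (intro card_mono) auto
    also have "\<dots> = card E - card P"
      using finE unfolding P_def by (intro card_Diff_subset) auto
    finally have "real (card {S. S \<subseteq> X \<and> (\<forall>z\<in>Z. S \<inter> N z \<noteq> {z})}) \<le> real (card E) - real (card P)"
      using card_mono[OF finE, of P] unfolding P_def by (simp add: of_nat_diff)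
    also have "\<dots> \<le> real (card E) * (1 - 1 / 2 ^ d)"
      using cP by (simp add: field_simps)
    also have "\<dots> \<le> 2 ^ card X * (1 - 1 / 2 ^ d) ^ r * (1 - 1 / 2 ^ d)"
      using IH by (intro mult_right_mono) auto
    finally show ?thesis by (simp add: mult_ac)
  qed
qed

section \<open>Expansion of circulant graphs\<close>

text \<open>The edges of step \<open>a\<close> in the circulant digraph that leave \<open>Y\<close>,
  named by their tails.\<close>

definition shift_boundary :: "nat \<Rightarrow> nat set \<Rightarrow> nat \<Rightarrow> nat set" where
  "shift_boundary n Y a = {x. x < n \<and> x \<in> Y \<and> (x + a) mod n \<notin> Y}"

lemma finite_shift_boundary [simp]: "finite (shift_boundary n Y a)"
  unfolding shift_boundary_def by simp

lemma inj_on_shift_mod: "inj_on (\<lambda>x. (x + a) mod n) {..<n::nat}"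
proof (rule inj_onI)
  fix x y
  assume "x \<in> {..<n}" "y \<in> {..<n}" "(x + a) mod n = (y + a) mod n"
  moreover from this obtain p q where "x + a + n * p = y + a + n * q"
    unfolding nat_mod_eq_iff by blast
  then have "x mod n = y mod n"
    unfolding nat_mod_eq_iff by (intro exI[of _ p] exI[of _ q]) simp
  ultimately show "x = y" by simp
qed

text \<open>A move by \<open>a + b\<close> out of \<open>Y\<close> leaves \<open>Y\<close> in one of
  its two halves; the second half starts at the shifted point, and shifting is injective.\<close>

lemma card_shift_boundary_add:
  "card (shift_boundary n Y (a + b)) \<le> card (shift_boundary n Y a) + card (shift_boundary n Y b)"
proof -
  let ?f = "\<lambda>x. (x + a) mod n"
  define P where "P = {x. x < n \<and> ?f x \<in> shift_boundary n Y b}"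
  have "shift_boundary n Y (a + b) \<subseteq> shift_boundary n Y a \<union> P"
    unfolding shift_boundary_def P_def by (auto simp: mod_simps add.assoc)
  then have "card (shift_boundary n Y (a + b)) \<le> card (shift_boundary n Y a \<union> P)"
    unfolding P_def by (intro card_mono) auto
  also have "\<dots> \<le> card (shift_boundary n Y a) + card P"
    by (rule card_Un_le)
  also have "card P \<le> card (shift_boundary n Y b)"
    by (rule card_inj_on_le[of ?f])
      (auto simp: P_def intro: inj_on_subset[OF inj_on_shift_mod])
  finally show ?thesis by simp
qed

lemma card_shift_boundary_mult:
  "card (shift_boundary n Y (i * a)) \<le> i * card (shift_boundary n Y a)"
proof (induction i)
  case 0
  show ?case by (simp add: shift_boundary_def)
next
  case (Suc i)
  then show ?case
    using card_shift_boundary_add[of n Y a "i * a"] by simp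
qed

text \<open>The base-\<open>m\<close> digits of \<open>s\<close> split the shift into at most
  \<open>m\<close> shifts by each \<open>m ^ i\<close>; subadditivity does the rest.\<close>

lemma card_shift_boundary_digits:
  "s < m ^ j \<Longrightarrow> card (shift_boundary n Y s) \<le> (\<Sum>i<j. m * card (shift_boundary n Y (m ^ i)))"
proof (induction j arbitrary: s)
  case 0
  then show ?case by (simp add: shift_boundary_def)
next
  case (Suc j)
  have m: "m ^ j > 0" using Suc.prems by (cases "m = 0") auto
  have "card (shift_boundary n Y s)
      \<le> card (shift_boundary n Y (s mod m ^ j)) + card (shift_boundary n Y (s div m ^ j * m ^ j))"
    using card_shift_boundary_add[of n Y "s mod m ^ j" "s div m ^ j * m ^ j"]
    by (simp only: mod_div_mult_eq)
  also have "card (shift_boundary n Y (s mod m ^ j)) \<le> (\<Sum>i<j. m * card (shift_boundary n Y (m ^ i)))"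
    using m by (intro Suc.IH) simp
  also have "card (shift_boundary n Y (s div m ^ j * m ^ j)) \<le> m * card (shift_boundary n Y (m ^ j))"
  proof (rule order.trans[OF card_shift_boundary_mult mult_right_mono])
    show "s div m ^ j \<le> m"
      using Suc.prems by (simp add: less_mult_imp_div_less mult.commute less_imp_le)
  qed simp
  finally show ?case by simp
qed

text \<open>Averaging over all shifts, some shift has a large boundary; subadditivity transfers this to a
  power of \<open>m\<close>.\<close>

lemma large_shift_boundary:
  assumes n: "n = m ^ k" and "k > 0"
  shows "\<exists>j<k. card (Y \<inter> {..<n}) * card ({..<n} - Y) \<le> n * (k * m) * card (shift_boundary n Y (m ^ j))"
proof -
  let ?b = "\<lambda>s. shift_boundary n Y s"
  define M where "M = Max ((\<lambda>j. card (?b (m ^ j))) ` {..<k})"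
  have "M \<in> (\<lambda>j. card (?b (m ^ j))) ` {..<k}"
    unfolding M_def using \<open>k > 0\<close> by (intro Max_in) auto
  then obtain j where j: "j < k" "card (?b (m ^ j)) = M" by auto
  have M: "card (?b (m ^ i)) \<le> M" if "i < k" for i
    unfolding M_def using that by (intro Max_ge) auto
  have b: "card (?b s) \<le> k * m * M" if "s < n" for s
  proof -
    have "card (?b s) \<le> (\<Sum>i<k. m * card (?b (m ^ i)))"
      using that n by (intro card_shift_boundary_digits) simp
    also have "\<dots> \<le> (\<Sum>i<k. m * M)"
      using M by (intro sum_mono mult_left_mono) auto
    finally show ?thesis by simp
  qed
  \<comment> \<open>A pair leading out of \<open>Y\<close> is determined by its difference and its
    first point, a boundary point for that shift; \<open>+ n\<close> keeps the subtraction from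
    truncating.\<close>
  let ?f = "\<lambda>(x, y). ((y + n - x) mod n, x)"
  have rec: "(x + (y + n - x) mod n) mod n = y" if "x < n" "y < n" for x y
    using that by (simp add: mod_simps)
  have "card ((Y \<inter> {..<n}) \<times> ({..<n} - Y)) \<le> card (Sigma {..<n} ?b)"
  proof (rule card_inj_on_le)
    show "inj_on ?f ((Y \<inter> {..<n}) \<times> ({..<n} - Y))"
      by (intro inj_onI) (clarsimp, metis rec)
    show "?f ` ((Y \<inter> {..<n}) \<times> ({..<n} - Y)) \<subseteq> Sigma {..<n} ?b"
      using rec by (auto simp: shift_boundary_def)
  qed auto
  also have "\<dots> = (\<Sum>s<n. card (?b s))"
    by simp
  also have "\<dots> \<le> (\<Sum>s<n. k * m * M)"
    using b by (intro sum_mono) auto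
  finally show ?thesis
    using j by (auto simp: card_cartesian_product mult.assoc)
qed

section \<open>Clauses as words in trees\<close>

text \<open>Each edge is identified with its lower end, so labels become a function of vertices.
  This is a tree with root \<open>0\<close> once parents are numbered below their children.\<close>

definition parent_tree :: "nat \<Rightarrow> (nat \<Rightarrow> nat) \<Rightarrow> (nat \<Rightarrow> 'l) \<Rightarrow> (nat, 'l) lgraph" where
  "parent_tree K p l = \<lparr>verts = {..K}, edges = (\<lambda>v. (p v, v)) ` {1..K}, lab = (\<lambda>e. l (snd e))\<rparr>"

lemma downward_tree_parent_tree:
  assumes p: "\<And>v. 0 < v \<Longrightarrow> v \<le> K \<Longrightarrow> p v < v" and l: "\<And>v. 0 < v \<Longrightarrow> v \<le> K \<Longrightarrow> l v \<in> \<sigma>"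
  shows "downward_tree \<sigma> (parent_tree K p l)"
proof -
  have edge: "(u, v) \<in> edges (parent_tree K p l) \<longleftrightarrow> u = p v \<and> 0 < v \<and> v \<le> K" for u v
    by (auto simp: parent_tree_def)
  have reach: "v \<le> K \<longrightarrow> (0, v) \<in> (edges (parent_tree K p l))\<^sup>*" for v
  proof (induction v rule: less_induct)
    case (less v)
    show ?case
    proof (cases "v = 0")
      case False
      show ?thesis
      proof
        assume "v \<le> K"
        with False p[of v] less.IH[of "p v"] have "(0, p v) \<in> (edges (parent_tree K p l))\<^sup>*"
          by auto
        moreover have "(p v, v) \<in> edges (parent_tree K p l)"
          using False \<open>v \<le> K\<close> edge by simp
        ultimately show "(0, v) \<in> (edges (parent_tree K p l))\<^sup>*"
          by (rule rtrancl_into_rtrancl)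
      qed
    qed simp
  qed
  have "graph_over \<sigma> (parent_tree K p l)"
    unfolding graph_over_def
  proof (intro conjI)
    show "edges (parent_tree K p l) \<subseteq> verts (parent_tree K p l) \<times> verts (parent_tree K p l)"
    proof
      fix e
      assume "e \<in> edges (parent_tree K p l)"
      then obtain v where "e = (p v, v)" "0 < v" "v \<le> K"
        by (auto simp: parent_tree_def)
      with p[of v] show "e \<in> verts (parent_tree K p l) \<times> verts (parent_tree K p l)"
        by (simp add: parent_tree_def)
    qed
    show "lab (parent_tree K p l) ` edges (parent_tree K p l) \<subseteq> \<sigma>"
      using l by (auto simp: parent_tree_def)
  qed (auto simp: parent_tree_def)
  moreover have "verts (parent_tree K p l) = {..K}"
    by (simp add: parent_tree_def)
  ultimately show ?thesis
    unfolding downward_tree_def using edge reach by (auto intro!: bexI[of _ 0])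
qed

lemma gsize_parent_tree: "gsize (parent_tree K p l) = K"
  unfolding gsize_def parent_tree_def by (simp add: card_image inj_on_def)

definition letter :: "'l \<Rightarrow> 'l \<Rightarrow> nat \<Rightarrow> nat \<Rightarrow> 'l" where
  "letter a b c i = (if bit c i then a else b)"

lemma letter_inject:
  assumes "a \<noteq> b" "c < 2 ^ L" "c' < 2 ^ L" "\<And>i. i < L \<Longrightarrow> letter a b c i = letter a b c' i"
  shows "c = c'"
proof (rule bit_eqI)
  fix i
  show "bit c i = bit c' i"
  proof (cases "i < L")
    case True
    then show ?thesis
      using assms(1) assms(4)[OF True] by (auto simp: letter_def split: if_splits)
  next
    case False
    then have "(2::nat) ^ L \<le> 2 ^ i" by simp
    then have "c < 2 ^ i" "c' < 2 ^ i"
      using assms(2,3) by linarith+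
    then show ?thesis by (simp add: bit_iff_odd)
  qed
qed

text \<open>The query is a spider with one leg per clause \<open>c < Q\<close>, spelling \<open>a\<close> followed by the \<open>L\<close>-letter
  binary word of \<open>c\<close>; position \<open>i\<close> of leg \<open>c\<close> is the vertex \<open>Suc (i * Q + c)\<close>. In the instance,
  the edge from the root to \<open>Suc v\<close> stands for the variable \<open>v < n\<close>, and \<open>q < 2 * Q\<close> stands for a
  literal of the clause \<open>q div 2\<close>, whose variable is \<open>e q\<close>: below \<open>Suc (e q)\<close> hangs a path
  spelling the word of \<open>q div 2\<close>, with vertices \<open>Suc (n + i * (2 * Q) + q)\<close> for \<open>i < L\<close>.\<close>

definition clause_query :: "'l \<Rightarrow> 'l \<Rightarrow> nat \<Rightarrow> nat \<Rightarrow> (nat, 'l) lgraph" where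
  "clause_query a b Q L = parent_tree (Q * Suc L) (\<lambda>v. v - Q)
     (\<lambda>v. if v \<le> Q then a else letter a b ((v - 1) mod Q) ((v - 1) div Q - 1))"

definition clause_instance ::
    "'l \<Rightarrow> 'l \<Rightarrow> nat \<Rightarrow> (nat \<Rightarrow> nat) \<Rightarrow> nat \<Rightarrow> nat \<Rightarrow> (nat, 'l) lgraph" where
  "clause_instance a b n e Q L = parent_tree (n + 2 * Q * L)
     (\<lambda>v. if v \<le> n then 0 else if v \<le> n + 2 * Q then Suc (e (v - 1 - n)) else v - 2 * Q)
     (\<lambda>v. if v \<le> n then a
          else letter a b ((v - 1 - n) mod (2 * Q) div 2) ((v - 1 - n) div (2 * Q)))"

lemma downward_tree_clause_query:
  "Q > 0 \<Longrightarrow> {a, b} \<subseteq> \<sigma> \<Longrightarrow> downward_tree \<sigma> (clause_query a b Q L)"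
  unfolding clause_query_def by (rule downward_tree_parent_tree) (auto simp: letter_def)

lemma downward_tree_clause_instance:
  assumes "Q > 0" and e: "\<And>q. q < 2 * Q \<Longrightarrow> e q < n" and "{a, b} \<subseteq> \<sigma>"
  shows "downward_tree \<sigma> (clause_instance a b n e Q L)"
  unfolding clause_instance_def
proof (rule downward_tree_parent_tree)
  fix v :: nat
  assume "0 < v"
  show "(if v \<le> n then 0 else if v \<le> n + 2 * Q then Suc (e (v - 1 - n)) else v - 2 * Q) < v"
  proof (cases "n < v \<and> v \<le> n + 2 * Q")
    case True
    then have "v - 1 - n < 2 * Q" by linarith
    from e[OF this] True show ?thesis by simp
  qed (use assms(1) \<open>0 < v\<close> in auto)
qed (use assms(3) in \<open>simp add: letter_def\<close>)

lemma clause_query_edges: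
  assumes "Q > 0"
  shows "(u, v) \<in> edges (clause_query a b Q L) \<longleftrightarrow>
    (\<exists>c<Q. u = 0 \<and> v = Suc c) \<or> (\<exists>c<Q. \<exists>i<L. u = Suc (i * Q + c) \<and> v = Suc (Suc i * Q + c))"
    (is "?lhs \<longleftrightarrow> ?rhs")
proof
  assume ?lhs
  then have v: "0 < v" "v \<le> Q * Suc L" "u = v - Q"
    by (auto simp: clause_query_def parent_tree_def)
  define i c where "i = (v - 1) div Q" and "c = (v - 1) mod Q"
  have c: "c < Q" and v_eq: "v = Suc (i * Q + c)"
    using assms v(1) unfolding i_def c_def by auto
  have "i * Q < Suc L * Q"
    using v(2) v_eq by (simp add: mult.commute)
  then have "i \<le> L" by (metis less_Suc_eq_le mult_less_cancel2)
  show ?rhs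
  proof (cases i)
    case 0
    then show ?thesis using c v_eq v(3) by auto
  next
    case (Suc j)
    then show ?thesis using c v_eq v(3) \<open>i \<le> L\<close> by (intro disjI2 exI[of _ c] exI[of _ j]) auto
  qed
next
  assume ?rhs
  then show ?lhs
  proof (elim disjE exE conjE)
    fix c
    assume "c < Q" "u = 0" "v = Suc c"
    then show ?lhs
      by (auto simp: clause_query_def parent_tree_def intro!: image_eqI[of _ _ v])
  next
    fix c i
    assume *: "c < Q" "i < L" "u = Suc (i * Q + c)" "v = Suc (Suc i * Q + c)"
    have "Suc (Suc i) * Q \<le> Suc L * Q"
      using \<open>i < L\<close> by (intro mult_right_mono) auto
    then show ?lhs
      using * by (auto simp: clause_query_def parent_tree_def mult.commute image_iff)
  qed
qed

lemma clause_query_lab: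
  assumes "c < Q"
  shows "lab (clause_query a b Q L) (u, Suc c) = a"
    "lab (clause_query a b Q L) (u, Suc (Suc i * Q + c)) = letter a b c i"
proof -
  have "\<not> Suc (Suc i * Q + c) \<le> Q" by simp
  then show "lab (clause_query a b Q L) (u, Suc (Suc i * Q + c)) = letter a b c i"
    using assms by (simp add: clause_query_def parent_tree_def del: mult_Suc)
qed (use assms in \<open>simp add: clause_query_def parent_tree_def\<close>)

lemma clause_instance_edges:
  "(u, v) \<in> edges (clause_instance a b n e Q L) \<longleftrightarrow> 0 < v \<and> v \<le> n + 2 * Q * L \<and>
    u = (if v \<le> n then 0 else if v \<le> n + 2 * Q then Suc (e (v - 1 - n)) else v - 2 * Q)"
  unfolding clause_instance_def parent_tree_def by (auto intro!: image_eqI[of _ _ v])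

lemma clause_instance_lab:
  assumes "q < 2 * Q"
  shows "v < n \<Longrightarrow> lab (clause_instance a b n e Q L) (u, Suc v) = a"
    "lab (clause_instance a b n e Q L) (u, Suc (n + i * (2 * Q) + q)) = letter a b (q div 2) i"
  using assms by (auto simp: clause_instance_def parent_tree_def)

lemma clause_instance_path:
  assumes "q < 2 * Q" "i < L"
  shows "(if i = 0 then Suc (e q) else Suc (n + (i - 1) * (2 * Q) + q), Suc (n + i * (2 * Q) + q))
    \<in> edges (clause_instance a b n e Q L)"
proof -
  have "Suc i * (2 * Q) \<le> L * (2 * Q)"
    using assms(2) by (intro mult_right_mono) auto
  then have "Suc (n + i * (2 * Q) + q) \<le> n + 2 * Q * L"
    using assms(1) by (simp add: mult.commute mult.left_commute)
  then show ?thesis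
    using assms(1) by (cases i) (auto simp: clause_instance_edges)
qed

text \<open>Levels are read off the numbering: the root, then the \<open>n\<close> variables, then
  blocks of \<open>2 * Q\<close> path vertices.\<close>

definition depth :: "nat \<Rightarrow> nat \<Rightarrow> nat \<Rightarrow> nat" where
  "depth n Q v = (if v = 0 then 0 else if v \<le> n then 1 else 2 + (v - 1 - n) div (2 * Q))"

lemma depth_edge:
  assumes "Q > 0" "\<And>q. q < 2 * Q \<Longrightarrow> e q < n" "(u, v) \<in> edges (clause_instance a b n e Q L)"
  shows "depth n Q v = Suc (depth n Q u)"
proof -
  have v: "0 < v" "u = (if v \<le> n then 0 else if v \<le> n + 2 * Q then Suc (e (v - 1 - n)) else v - 2 * Q)"
    using assms(3) by (auto simp: clause_instance_edges)
  consider "v \<le> n" | "n < v" "v \<le> n + 2 * Q" | "n + 2 * Q < v" by linarith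
  then show ?thesis
  proof cases
    case 1
    with v show ?thesis by (simp add: depth_def)
  next
    case 2
    then have "v - 1 - n < 2 * Q" by simp
    with 2 v assms(2)[of "v - 1 - n"] show ?thesis by (simp add: depth_def)
  next
    case 3
    then have "(v - 1 - n) div (2 * Q) = Suc ((v - 1 - n - 2 * Q) div (2 * Q))"
      using assms(1) by (intro le_div_geq) auto
    moreover have "v - 1 - n - 2 * Q = u - 1 - n"
      using 3 v by simp
    ultimately show ?thesis using 3 v by (simp add: depth_def)
  qed
qed

lemma depth_le:
  assumes "v \<le> n + 2 * Q * L" "L > 0"
  shows "depth n Q v \<le> Suc L"
proof (cases "v \<le> n")
  case False
  then have "v - 1 - n < L * (2 * Q)"
    using assms by (simp add: mult.commute mult.left_commute)
  then have "(v - 1 - n) div (2 * Q) < L"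
    by (rule less_mult_imp_div_less)
  with False show ?thesis by (simp add: depth_def)
qed (auto simp: depth_def)

text \<open>Every leg of the query is as long as the instance is deep, so the root must go to the root.\<close>

lemma Prov_clauses_necessary:
  assumes "a \<noteq> b" "Q > 0" "L > 0" "Q \<le> 2 ^ L" and e: "\<And>q. q < 2 * Q \<Longrightarrow> e q < n"
    and prov: "Prov (clause_query a b Q L) (clause_instance a b n e Q L) \<nu>" and c: "c < Q"
  shows "\<exists>q. q div 2 = c \<and> \<nu> (0, Suc (e q))"
proof -
  let ?G = "clause_query a b Q L" and ?H = "clause_instance a b n e Q L"
  obtain h where h: "hom ?G (restrict_edges ?H \<nu>) h"
    using prov unfolding Prov_def has_hom_def by blast
  have hE: "(h u, h v) \<in> edges ?H \<and> \<nu> (h u, h v) \<and> lab ?H (h u, h v) = lab ?G (u, v)"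
    if "(u, v) \<in> edges ?G" for u v
    using h that unfolding hom_def restrict_edges_def by auto
  define x where "x = (\<lambda>i. h (Suc (i * Q + c)))"
  have "(0, Suc c) \<in> edges ?G"
    using c assms(2) by (auto simp: clause_query_edges)
  from hE[OF this] have x0: "(h 0, x 0) \<in> edges ?H" "\<nu> (h 0, x 0)"
    by (simp_all add: x_def)
  have xS: "(x i, x (Suc i)) \<in> edges ?H \<and> lab ?H (x i, x (Suc i)) = letter a b c i" if "i < L" for i
  proof -
    have "(Suc (i * Q + c), Suc (Suc i * Q + c)) \<in> edges ?G"
      using c that assms(2) by (auto simp: clause_query_edges)
    from hE[OF this] show ?thesis
      unfolding x_def clause_query_lab[OF c] by blast
  qed
  have dx: "i \<le> L \<longrightarrow> depth n Q (x i) = depth n Q (h 0) + Suc i" for i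
  proof (induction i)
    case 0
    then show ?case using depth_edge[OF assms(2) e x0(1)] by simp
  next
    case (Suc i)
    show ?case
    proof
      assume i: "Suc i \<le> L"
      then have "(x i, x (Suc i)) \<in> edges ?H" using xS[of i] by simp
      from depth_edge[OF assms(2) e this] Suc i
      show "depth n Q (x (Suc i)) = depth n Q (h 0) + Suc (Suc i)" by simp
    qed
  qed
  have "(x (L - 1), x L) \<in> edges ?H"
    using xS[of "L - 1"] assms(3) by simp
  then have "depth n Q (x L) \<le> Suc L"
    using assms(3) by (intro depth_le) (auto simp: clause_instance_edges)
  with dx[of L] have "depth n Q (h 0) = 0" by simp
  then have h0: "h 0 = 0" by (simp add: depth_def split: if_splits)
  have dx: "depth n Q (x i) = Suc i" if "i \<le> L" for i
    using dx[of i] that h0 by (simp add: depth_def)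
  \<comment> \<open>The second vertex of the leg lands on depth 2, the top of the path of some
    literal \<open>q\<close>. Paths do not branch, so the remaining images are determined.\<close>
  define q where "q = x 1 - 1 - n"
  have "n < x 1"
    using dx[of 1] assms(3) by (auto simp: depth_def split: if_splits)
  moreover have "(x 1 - 1 - n) div (2 * Q) = 0"
    using dx[of 1] assms(3) by (auto simp: depth_def split: if_splits)
  then have q: "q < 2 * Q"
    unfolding q_def using assms(2) by (simp add: div_eq_0_iff)
  ultimately have x1: "x 1 = Suc (n + q)"
    unfolding q_def by simp
  have "x 0 = Suc (e q)"
    using xS[of 0] assms(3) q x1 by (simp add: clause_instance_edges)
  with x0 h0 have "\<nu> (0, Suc (e q))" by simp
  moreover have xi: "i < L \<longrightarrow> x (Suc i) = Suc (n + i * (2 * Q) + q)" for i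
  proof (induction i)
    case 0
    then show ?case using x1 by simp
  next
    case (Suc i)
    show ?case
    proof
      assume i: "Suc i < L"
      then have "\<not> x (Suc (Suc i)) \<le> n" "(x (Suc (Suc i)) - 1 - n) div (2 * Q) = Suc i"
        using dx[of "Suc (Suc i)"] by (auto simp: depth_def split: if_splits)
      from this(2) have "(x (Suc (Suc i)) - 1 - n) div (2 * Q) \<noteq> 0" by simp
      then have "\<not> x (Suc (Suc i)) \<le> n + 2 * Q"
      proof (rule contrapos_nn)
        assume "x (Suc (Suc i)) \<le> n + 2 * Q"
        with \<open>\<not> x (Suc (Suc i)) \<le> n\<close> have "x (Suc (Suc i)) - 1 - n < 2 * Q" by simp
        then show "(x (Suc (Suc i)) - 1 - n) div (2 * Q) = 0" by simp
      qed
      then have "x (Suc i) = x (Suc (Suc i)) - 2 * Q" "\<not> x (Suc (Suc i)) \<le> n + 2 * Q"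
        using xS[OF i] by (simp_all add: clause_instance_edges)
      then show "x (Suc (Suc i)) = Suc (n + Suc i * (2 * Q) + q)"
        using Suc i by simp
    qed
  qed
  \<comment> \<open>Leg and path spell the words of \<open>c\<close> and \<open>q div 2\<close>, and
    \<open>L\<close> letters tell numbers below \<open>2 ^ L\<close> apart.\<close>
  have "letter a b (q div 2) i = letter a b c i" if "i < L" for i
    using xS[OF that] xi[of i] that clause_instance_lab(2)[OF q] by metis
  then have "q div 2 = c"
    using q c assms(4) by (intro letter_inject[OF assms(1), of _ L]) auto
  ultimately show ?thesis by blast
qed

text \<open>The root goes to the root and leg \<open>c\<close> down the path of a true literal of
  its clause. Legs may share a variable edge, since homomorphisms need not be injective.\<close>

lemma Prov_clauses_sufficient:
  assumes "Q > 0" and e: "\<And>q. q < 2 * Q \<Longrightarrow> e q < n"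
    and rest: "\<And>u v. u \<noteq> 0 \<Longrightarrow> \<nu> (u, v)"
    and sat: "\<And>c. c < Q \<Longrightarrow> \<exists>q. q div 2 = c \<and> \<nu> (0, Suc (e q))"
  shows "Prov (clause_query a b Q L) (clause_instance a b n e Q L) \<nu>"
proof -
  let ?G = "clause_query a b Q L" and ?H = "clause_instance a b n e Q L"
  obtain s where s: "\<And>c. c < Q \<Longrightarrow> s c div 2 = c \<and> \<nu> (0, Suc (e (s c)))"
    using sat by metis
  have s2: "s c < 2 * Q" if "c < Q" for c
    using s[OF that] that by linarith
  define f where "f = (\<lambda>i c. if i = 0 then Suc (e (s c)) else Suc (n + (i - 1) * (2 * Q) + s c))"
  define h where "h = (\<lambda>v. if v = 0 then 0 else f ((v - 1) div Q) ((v - 1) mod Q))"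
  have h: "h (Suc (i * Q + c)) = f i c" if "c < Q" for i c
    using that unfolding h_def by simp
  have edge: "(h u, h v) \<in> edges ?H \<and> \<nu> (h u, h v) \<and> lab ?H (h u, h v) = lab ?G (u, v)"
    if "(u, v) \<in> edges ?G" for u v
    using that unfolding clause_query_edges[OF assms(1)]
  proof (elim disjE exE conjE)
    fix c
    assume *: "c < Q" "u = 0" "v = Suc c"
    have "h u = 0" "h v = Suc (e (s c))"
      using * h[of c 0] by (simp_all add: h_def f_def)
    then show ?thesis
      using * s[of c] e[OF s2[of c]]
      by (simp add: clause_instance_edges clause_query_lab clause_instance_lab(1)[of 0])
  next
    fix c i
    assume *: "c < Q" "i < L" "u = Suc (i * Q + c)" "v = Suc (Suc i * Q + c)"
    have huv: "h u = (if i = 0 then Suc (e (s c)) else Suc (n + (i - 1) * (2 * Q) + s c))"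
      "h v = Suc (n + i * (2 * Q) + s c)"
      using h[OF *(1), of i] h[OF *(1), of "Suc i"] * unfolding f_def by simp_all
    have "h u \<noteq> 0" unfolding huv by simp
    then have "\<nu> (h u, h v)" by (rule rest)
    moreover have "(h u, h v) \<in> edges ?H"
      unfolding huv by (rule clause_instance_path[OF s2[OF *(1)] *(2)])
    moreover have "lab ?H (h u, h v) = letter a b c i"
      unfolding huv(2) clause_instance_lab(2)[OF s2[OF *(1)]] using s[OF *(1)] by simp
    moreover have "lab ?G (u, v) = letter a b c i"
      unfolding *(4) by (rule clause_query_lab(2)[OF *(1)])
    ultimately show ?thesis by simp
  qed
  have hverts: "h v \<in> verts ?H" if "v \<in> verts ?G" for v
  proof (cases "v = 0")
    case True
    then show ?thesis by (simp add: h_def clause_instance_def parent_tree_def)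
  next
    case False
    with that have "(v - Q, v) \<in> edges ?G"
      by (auto simp: clause_query_def parent_tree_def)
    from edge[OF this] show ?thesis
      by (auto simp: clause_instance_def parent_tree_def)
  qed
  have "hom ?G (restrict_edges ?H \<nu>) h"
    using edge hverts unfolding hom_def restrict_edges_def by auto
  then show ?thesis
    unfolding Prov_def has_hom_def by blast
qed

section \<open>The lower bound\<close>

text \<open>Closed neighbourhoods in the undirected circulant graph; the last disjunct is the
  backward step, phrased without subtraction.\<close>

definition circulant_nbhd :: "nat \<Rightarrow> nat \<Rightarrow> nat \<Rightarrow> nat set" where
  "circulant_nbhd m k v = {u. u < m ^ k \<and>
     (u = v \<or> (\<exists>j<k. u = (v + m ^ j) mod m ^ k \<or> v = (u + m ^ j) mod m ^ k))}"

lemma card_circulant_nbhd: "card (circulant_nbhd m k v) \<le> 2 * k + 1"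
proof -
  define f where "f = (\<lambda>j u. (u + m ^ j) mod m ^ k)"
  have "circulant_nbhd m k v \<subseteq>
      insert v ((\<lambda>j. f j v) ` {..<k} \<union> (\<lambda>j. inv_into {..<m ^ k} (f j) v) ` {..<k})"
  proof
    fix u
    assume u: "u \<in> circulant_nbhd m k v"
    have "inv_into {..<m ^ k} (f j) (f j u) = u" for j
      using u inj_on_shift_mod[of "m ^ j" "m ^ k"]
      by (intro inv_into_f_f) (simp_all add: f_def circulant_nbhd_def)
    then have inv: "u = inv_into {..<m ^ k} (f j) v" if "v = f j u" for j
      using that by simp
    from u consider "u = v" | j where "j < k" "u = f j v" | j where "j < k" "v = f j u"
      unfolding circulant_nbhd_def f_def by blast
    then show "u \<in> insert v ((\<lambda>j. f j v) ` {..<k} \<union> (\<lambda>j. inv_into {..<m ^ k} (f j) v) ` {..<k})"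
      by cases (use inv in auto)
  qed
  then have "card (circulant_nbhd m k v) \<le>
      card (insert v ((\<lambda>j. f j v) ` {..<k} \<union> (\<lambda>j. inv_into {..<m ^ k} (f j) v) ` {..<k}))"
    by (intro card_mono) auto
  also have "\<dots> \<le> Suc (card ((\<lambda>j. f j v) ` {..<k} \<union> (\<lambda>j. inv_into {..<m ^ k} (f j) v) ` {..<k}))"
    by (rule card_insert_le_m1) auto
  also have "\<dots> \<le> Suc (card ((\<lambda>j. f j v) ` {..<k}) + card ((\<lambda>j. inv_into {..<m ^ k} (f j) v) ` {..<k}))"
    by (intro Suc_le_mono[THEN iffD2] card_Un_le)
  also have "\<dots> \<le> Suc (k + k)"
    using card_image_le[of "{..<k}"] by (intro Suc_le_mono[THEN iffD2] add_mono) auto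
  finally show ?thesis by simp
qed

lemma shift_power_neq:
  fixes x m :: nat
  assumes "x < m ^ k" "j < k" "m > 1"
  shows "(x + m ^ j) mod m ^ k \<noteq> x"
proof -
  have "m ^ j < m ^ k" "m ^ j > 0" using assms by simp_all
  then show ?thesis
    using assms(1) by (cases "x + m ^ j < m ^ k") (simp_all add: le_mod_geq)
qed

text \<open>The models are the vertex covers of the circulant graph.\<close>

definition circulant_cnf :: "nat \<Rightarrow> nat \<Rightarrow> (nat \<Rightarrow> bool) \<Rightarrow> bool" where
  "circulant_cnf m k \<beta> \<longleftrightarrow> (\<forall>j<k. \<forall>x<m ^ k. \<beta> x \<or> \<beta> ((x + m ^ j) mod m ^ k))"

text \<open>The clause for \<open>x\<close> and the step \<open>m ^ j\<close> has the number \<open>j * m ^ k + x\<close>.\<close>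

definition circulant_literal :: "nat \<Rightarrow> nat \<Rightarrow> nat \<Rightarrow> nat" where
  "circulant_literal m k q = (let c = q div 2; x = c mod m ^ k
     in if even q then x else (x + m ^ (c div m ^ k)) mod m ^ k)"

text \<open>Words of length \<open>2 * m\<close> distinguish all \<open>k * m ^ k\<close> clauses
  once \<open>m\<close> is large for fixed \<open>k\<close>, and cost only a factor of order
  \<open>m\<close> in size.\<close>

definition circulant_query :: "'l \<Rightarrow> 'l \<Rightarrow> nat \<Rightarrow> nat \<Rightarrow> (nat, 'l) lgraph" where
  "circulant_query a b m k = clause_query a b (k * m ^ k) (2 * m)"

definition circulant_instance :: "'l \<Rightarrow> 'l \<Rightarrow> nat \<Rightarrow> nat \<Rightarrow> (nat, 'l) lgraph" where
  "circulant_instance a b m k =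
     clause_instance a b (m ^ k) (circulant_literal m k) (k * m ^ k) (2 * m)"

lemma circulant_literal_less: "m > 0 \<Longrightarrow> circulant_literal m k q < m ^ k"
  by (simp add: circulant_literal_def Let_def)

lemma Prov_circulant_necessary:
  assumes "a \<noteq> b" "m > 0" "k * m ^ k \<le> 2 ^ (2 * m)"
    and prov: "Prov (circulant_query a b m k) (circulant_instance a b m k) \<nu>"
  shows "circulant_cnf m k (\<lambda>v. \<nu> (0, Suc v))"
  unfolding circulant_cnf_def
proof (intro allI impI)
  fix j x
  assume j: "j < k" and x: "x < m ^ k"
  have "Suc j * m ^ k \<le> k * m ^ k"
    using j by (intro mult_right_mono) auto
  with x have c: "j * m ^ k + x < k * m ^ k" by simp
  obtain q where q: "q div 2 = j * m ^ k + x" "\<nu> (0, Suc (circulant_literal m k q))"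
    using Prov_clauses_necessary[OF assms(1) _ _ assms(3) _ _ c] prov circulant_literal_less[OF assms(2)] c assms(2)
    unfolding circulant_query_def circulant_instance_def by (metis gr_zeroI not_less_zero nat_0_less_mult_iff zero_less_numeral)
  have "(j * m ^ k + x) mod m ^ k = x" "(j * m ^ k + x) div m ^ k = j"
    using x assms(2) by simp_all
  with q show "\<nu> (0, Suc x) \<or> \<nu> (0, Suc ((x + m ^ j) mod m ^ k))"
    by (auto simp: circulant_literal_def Let_def split: if_splits)
qed

lemma Prov_circulant_sufficient:
  assumes "m > 0" "k > 0"
    and rest: "\<And>u v. u \<noteq> 0 \<Longrightarrow> \<nu> (u, v)"
    and sat: "circulant_cnf m k (\<lambda>v. \<nu> (0, Suc v))"
  shows "Prov (circulant_query a b m k) (circulant_instance a b m k) \<nu>"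
  unfolding circulant_query_def circulant_instance_def
proof (rule Prov_clauses_sufficient)
  show "k * m ^ k > 0" using assms by simp
  show "circulant_literal m k q < m ^ k" for q
    by (rule circulant_literal_less[OF assms(1)])
  fix c
  assume c: "c < k * m ^ k"
  have "c div m ^ k < k" "c mod m ^ k < m ^ k"
    using c assms(1) by (simp_all add: less_mult_imp_div_less)
  with sat have "\<nu> (0, Suc (circulant_literal m k (2 * c)))
      \<or> \<nu> (0, Suc (circulant_literal m k (Suc (2 * c))))"
    by (simp add: circulant_cnf_def circulant_literal_def Let_def)
  moreover have "2 * c div 2 = c" "Suc (2 * c) div 2 = c" by simp_all
  ultimately show "\<exists>q. q div 2 = c \<and> \<nu> (0, Suc (circulant_literal m k q))"
    by blast
qed (use rest in auto)

text \<open>For a random set \<open>S\<close>, falsifying exactly the vertices isolated within \<open>S\<close> is a model.\<close>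

lemma circulant_cnf_isolated:
  assumes "m > 1"
  shows "circulant_cnf m k (\<lambda>v. S \<inter> circulant_nbhd m k v \<noteq> {v})"
  unfolding circulant_cnf_def
proof (intro allI impI, rule ccontr)
  fix j x
  assume j: "j < k" "x < m ^ k"
  let ?y = "(x + m ^ j) mod m ^ k"
  assume "\<not> (S \<inter> circulant_nbhd m k x \<noteq> {x} \<or> S \<inter> circulant_nbhd m k ?y \<noteq> {?y})"
  then have "S \<inter> circulant_nbhd m k x = {x}" "?y \<in> S" by auto
  moreover have "?y \<in> circulant_nbhd m k x"
    using j assms unfolding circulant_nbhd_def by auto
  ultimately have "?y = x" by blast
  with shift_power_neq[OF j(2,1) assms] show False by simp
qed

text \<open>A rectangle of models cannot contain models falsifying the two ends of a clause separately, so
  it satisfies one end of each clause crossing the partition.\<close>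

lemma circulant_rectangle_forced:
  assumes n: "n = m ^ k" and "m > 0" "k > 0" and t: "n \<le> 4 * t" "3 * t \<le> n"
    and Y: "t \<le> card (Y \<inter> {..<n})" "card (Y \<inter> {..<n}) < 2 * t"
    and R: "\<And>\<beta> \<beta>'. \<beta> \<in> R \<Longrightarrow> \<beta>' \<in> R \<Longrightarrow> circulant_cnf m k (mix Y \<beta> \<beta>')"
  shows "n \<le> 16 * (k * m) * card {v. v < n \<and> (\<forall>\<beta>\<in>R. \<beta> v)}"
proof -
  define Z where "Z = {v. v < n \<and> (\<forall>\<beta>\<in>R. \<beta> v)}"
  have "n > 0" using n \<open>m > 0\<close> by simp
  obtain j where j: "j < k"
    and b: "card (Y \<inter> {..<n}) * card ({..<n} - Y) \<le> n * (k * m) * card (shift_boundary n Y (m ^ j))"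
    using large_shift_boundary[OF n \<open>k > 0\<close>] by blast
  let ?B = "shift_boundary n Y (m ^ j)"
  have forced: "x \<in> Z \<or> (x + m ^ j) mod n \<in> Z" if x: "x \<in> ?B" for x
  proof (rule ccontr)
    assume "\<not> ?thesis"
    then obtain \<beta> \<beta>' where \<beta>: "\<beta> \<in> R" "\<not> \<beta> x" "\<beta>' \<in> R" "\<not> \<beta>' ((x + m ^ j) mod n)"
      using x \<open>n > 0\<close> unfolding Z_def shift_boundary_def by auto
    have "circulant_cnf m k (mix Y \<beta> \<beta>')"
      using R \<beta> by blast
    then have "mix Y \<beta> \<beta>' x \<or> mix Y \<beta> \<beta>' ((x + m ^ j) mod n)"
      using that j n unfolding circulant_cnf_def shift_boundary_def by blast
    with \<beta> that show False
      by (auto simp: mix_def shift_boundary_def)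
  qed
  have "card ?B \<le> card Z"
  proof (rule card_inj_on_le)
    \<comment> \<open>Each crossing clause is sent to a forced end. Tails lie in \<open>Y\<close>
      and heads outside it, so the crossing edges of one fixed step form a matching.\<close>
    let ?f = "\<lambda>x. if x \<in> Z then x else (x + m ^ j) mod n"
    show "inj_on ?f ?B"
    proof (rule inj_onI)
      fix x y
      assume x: "x \<in> ?B" and y: "y \<in> ?B" and "?f x = ?f y"
      then consider "x = y" | "(x + m ^ j) mod n = (y + m ^ j) mod n"
        | "x = (y + m ^ j) mod n" | "y = (x + m ^ j) mod n"
        by (auto split: if_splits)
      then show "x = y"
      proof cases
        case 2
        then show ?thesis
          using inj_onD[OF inj_on_shift_mod] x y unfolding shift_boundary_def by blast
      qed (use x y in \<open>auto simp: shift_boundary_def\<close>)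
    qed
    show "?f ` ?B \<subseteq> Z" using forced by auto
    show "finite Z" unfolding Z_def by simp
  qed
  have "card ({..<n} - Y) = card {..<n} - card ({..<n} \<inter> Y)"
    by (rule card_Diff_subset_Int) simp
  moreover have "{..<n} \<inter> Y = Y \<inter> {..<n}" by blast
  ultimately have "card ({..<n} - Y) = n - card (Y \<inter> {..<n})" by simp
  \<comment> \<open>Each side has at least \<open>t \<ge> n / 4\<close> vertices, so the product of
    their sizes is at least \<open>n * n / 16\<close>, whence the factor 16.\<close>
  then have "t \<le> card ({..<n} - Y)"
    using Y t by linarith
  then have "t * t \<le> card (Y \<inter> {..<n}) * card ({..<n} - Y)"
    using Y(1) by (intro mult_mono) auto
  then have "16 * (t * t) \<le> 16 * (n * (k * m) * card ?B)"
    using b by linarith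
  moreover have "n * n \<le> (4 * t) * (4 * t)"
    using t(1) by (intro mult_mono) auto
  moreover have "(4 * t) * (4 * t) = 16 * (t * t)" by simp
  moreover have "16 * (n * (k * m) * card ?B) = n * (16 * (k * m) * card ?B)"
    by (simp only: mult_ac)
  ultimately have "n * n \<le> n * (16 * (k * m) * card ?B)"
    by linarith
  then have "n \<le> 16 * (k * m) * card ?B"
    using \<open>n > 0\<close> by (simp add: mult_le_cancel1)
  also have "\<dots> \<le> 16 * (k * m) * card Z"
    using \<open>card ?B \<le> card Z\<close> by (intro mult_left_mono) auto
  finally show ?thesis unfolding Z_def .
qed

section \<open>Counting rectangles in a DNNF\<close>

text \<open>The function depends on every variable: when only the neighbour \<open>w\<close> is
  false, the clause of \<open>v\<close> and \<open>w\<close> makes \<open>v\<close> pivotal. So the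
  output gate sees enough variables for a balanced cover.\<close>

lemma circulant_gate_vars:
  assumes "a \<noteq> b" "m > 1" "k > 0" "k * m ^ k \<le> 2 ^ (2 * m)"
    and C: "circuit_on X C"
    and rep: "represents C (Prov (circulant_query a b m k) (circulant_instance a b m k))"
    and v: "v < m ^ k"
  shows "(0, Suc v) \<in> gate_vars C (outgate C)"
proof (rule ccontr)
  assume nv: "(0, Suc v) \<notin> gate_vars C (outgate C)"
  let ?P = "Prov (circulant_query a b m k) (circulant_instance a b m k)"
  define w where "w = (v + m ^ 0) mod m ^ k"
  have "w \<noteq> v"
    unfolding w_def using shift_power_neq[OF v assms(3,2)] .
  define \<nu> where "\<nu> = (\<lambda>e. e \<noteq> (0::nat, Suc w))"
  have "?P \<nu>"
  proof (rule Prov_circulant_sufficient)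
    show "circulant_cnf m k (\<lambda>u. \<nu> (0, Suc u))"
      unfolding circulant_cnf_def \<nu>_def using shift_power_neq[OF _ _ assms(2)] by force
  qed (use assms in \<open>auto simp: \<nu>_def\<close>)
  moreover have "\<not> ?P (\<nu>((0, Suc v) := False))"
  proof
    assume P: "?P (\<nu>((0, Suc v) := False))"
    have "circulant_cnf m k (\<lambda>u. (\<nu>((0, Suc v) := False)) (0, Suc u))"
      using assms(2) by (intro Prov_circulant_necessary[OF assms(1) _ assms(4) P]) simp
    then have "(\<nu>((0, Suc v) := False)) (0, Suc v) \<or> (\<nu>((0, Suc v) := False)) (0, Suc w)"
      using v assms(3) unfolding circulant_cnf_def w_def by blast
    then show False
      by (auto simp: \<nu>_def split: if_splits)
  qed
  moreover have "gate_value C \<nu> (outgate C) = gate_value C (\<nu>((0, Suc v) := False)) (outgate C)"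
    using nv C by (intro gate_value_cong[OF C]) (auto simp: circuit_on_def)
  ultimately show False
    using rep unfolding represents_def by blast
qed

text \<open>Union bound over wires: each of the \<open>2 ^ n\<close> sets \<open>S\<close> gives a
  model \<open>\<mu> S\<close> in the rectangle of some wire, and one rectangle receives at most a
  \<open>(1 - 1 / 2 ^ d) ^ r\<close> fraction of them.\<close>

theorem circulant_DNNF_size:
  fixes C :: "('g, nat \<times> nat) circuit"
  assumes "a \<noteq> b" "m \<ge> 3" "k \<ge> 2" "k * m ^ k \<le> 2 ^ (2 * m)" and d: "d = 2 * k + 1"
    and DNNF: "DNNF_on X C"
    and rep: "represents C (Prov (circulant_query a b m k) (circulant_instance a b m k))"
  shows "1 \<le> real (circuit_size C) * (1 - 1 / 2 ^ d) ^ (m ^ k div (16 * (k * m) * d\<^sup>2))"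
proof -
  define n where "n = m ^ k"
  \<comment> \<open>The factor \<open>16 * (k * m)\<close> comes from the count of forced vertices,
    \<open>d\<^sup>2\<close> from the greedy choice among them.\<close>
  define r where "r = n div (16 * (k * m) * d\<^sup>2)"
  \<comment> \<open>With a third, a side of fewer than \<open>2 * t\<close> vertices leaves at least
    \<open>t\<close> to the other.\<close>
  define t where "t = n div 3"
  define N where "N = circulant_nbhd m k"
  define \<mu> where "\<mu> = (\<lambda>S (u::nat, w). u = 0 \<longrightarrow> S \<inter> N (w - 1) \<noteq> {w - 1})"
  define U where "U = (\<lambda>v. (0::nat, Suc v)) ` {..<n}"
  let ?P = "Prov (circulant_query a b m k) (circulant_instance a b m k)"
  have C: "circuit_on X C" using DNNF by (simp add: DNNF_on_def)
  have finW: "finite (wires C)"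
    using C unfolding circuit_on_def by (meson finite_SigmaI finite_subset)
  \<comment> \<open>From 9 on, rounding down in \<open>n div 3\<close> still leaves
    \<open>t \<ge> n / 4\<close> and \<open>t \<ge> 2\<close>.\<close>
  have "3 ^ 2 \<le> m ^ 2" using assms(2) by (intro power_mono) auto
  also have "\<dots> \<le> m ^ k" using assms(2,3) by (intro power_increasing) auto
  finally have n9: "9 \<le> n" by (simp add: n_def)
  then have t: "n \<le> 4 * t" "3 * t \<le> n" "2 \<le> t"
    unfolding t_def by linarith+
  have cnf: "circulant_cnf m k (\<lambda>v. \<nu> (0, Suc v))" if "gate_value C \<nu> (outgate C)" for \<nu>
    using that rep assms by (intro Prov_circulant_necessary[of a b]) (auto simp: represents_def)
  have model: "gate_value C (\<mu> S) (outgate C)" for S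
  proof -
    have "?P (\<mu> S)"
      using assms circulant_cnf_isolated[of m k S]
      by (intro Prov_circulant_sufficient) (auto simp: \<mu>_def N_def)
    with rep show ?thesis by (simp add: represents_def)
  qed
  have "U \<subseteq> gate_vars C (outgate C)"
    using circulant_gate_vars[OF assms(1) _ _ assms(4) C rep] assms unfolding U_def n_def by auto
  moreover have "card U = n"
    unfolding U_def by (simp add: card_image inj_on_def)
  ultimately have tU: "t \<le> card (gate_vars C (outgate C) \<inter> U)"
    using t by (simp add: Int_absorb1)
  define good where "good = {e \<in> wires C. \<exists>Y. t \<le> card (Y \<inter> U) \<and> card (Y \<inter> U) < 2 * t \<and>
    (\<forall>\<nu>1 \<in> wire_models C e. \<forall>\<nu>2 \<in> wire_models C e. gate_value C (mix Y \<nu>1 \<nu>2) (outgate C))}"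
  define M where "M = (\<lambda>e. {S. S \<subseteq> {..<n} \<and> \<mu> S \<in> wire_models C e})"
  have "Pow {..<n} \<subseteq> (\<Union>e\<in>good. M e)"
  proof
    fix S
    assume "S \<in> Pow {..<n}"
    moreover obtain e where "e \<in> good" "\<mu> S \<in> wire_models C e"
      using DNNF_balanced_rectangle_cover[OF DNNF _ t(3) tU model[of S]]
      unfolding good_def U_def by blast
    ultimately show "S \<in> (\<Union>e\<in>good. M e)"
      unfolding M_def by blast
  qed
  moreover have fin_good: "finite good" and "finite (M e)" for e
    using finW unfolding good_def M_def by simp_all
  ultimately have "card (Pow {..<n}) \<le> card (\<Union>e\<in>good. M e)"
    by (intro card_mono) auto
  also have "\<dots> \<le> (\<Sum>e\<in>good. card (M e))"
    by (rule card_UN_le[OF fin_good])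
  finally have "2 ^ n \<le> (\<Sum>e\<in>good. card (M e))"
    by (simp add: card_Pow)
  then have "real (2 ^ n) \<le> real (\<Sum>e\<in>good. card (M e))"
    by (rule of_nat_mono)
  then have "2 ^ n \<le> (\<Sum>e\<in>good. real (card (M e)))"
    by simp
  also have "\<dots> \<le> (\<Sum>e\<in>good. 2 ^ n * (1 - 1 / 2 ^ d) ^ r)"
  proof (rule sum_mono)
    fix e
    assume "e \<in> good"
    then obtain Y where Y: "t \<le> card (Y \<inter> U)" "card (Y \<inter> U) < 2 * t"
      and mix: "\<And>\<nu>1 \<nu>2. \<nu>1 \<in> wire_models C e \<Longrightarrow> \<nu>2 \<in> wire_models C e \<Longrightarrow>
        gate_value C (mix Y \<nu>1 \<nu>2) (outgate C)"
      unfolding good_def by blast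
    \<comment> \<open>The rectangle is transported from edges at the root to vertices;
      \<open>Z\<close> collects the vertices true in all its members.\<close>
    define Y' where "Y' = {v. (0, Suc v) \<in> Y}"
    define R where "R = (\<lambda>\<nu> v. \<nu> (0, Suc v)) ` wire_models C e"
    define Z where "Z = {v. v < n \<and> (\<forall>\<beta>\<in>R. \<beta> v)}"
    have "Y \<inter> U = (\<lambda>v. (0, Suc v)) ` (Y' \<inter> {..<n})"
      unfolding U_def Y'_def by auto
    then have "card (Y \<inter> U) = card (Y' \<inter> {..<n})"
      by (simp add: card_image inj_on_def)
    moreover have "circulant_cnf m k (mix Y' \<beta> \<beta>')" if \<beta>: "\<beta> \<in> R" "\<beta>' \<in> R" for \<beta> \<beta>'
    proof -
      obtain \<nu> \<nu>' where \<nu>: "\<nu> \<in> wire_models C e" "\<nu>' \<in> wire_models C e"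
        "\<beta> = (\<lambda>v. \<nu> (0, Suc v))" "\<beta>' = (\<lambda>v. \<nu>' (0, Suc v))"
        using \<beta> unfolding R_def by blast
      have "mix Y' \<beta> \<beta>' = (\<lambda>v. mix Y \<nu> \<nu>' (0, Suc v))"
        unfolding \<nu>(3,4) Y'_def by (auto simp: mix_def)
      with cnf[OF mix[OF \<nu>(1,2)]] show ?thesis by simp
    qed
    ultimately have "n \<le> 16 * (k * m) * card Z"
      unfolding Z_def using Y t assms by (intro circulant_rectangle_forced[of n m k t Y']) (auto simp: n_def)
    moreover have "r * (16 * (k * m) * d\<^sup>2) \<le> n"
      unfolding r_def by simp
    moreover have "16 * (k * m) * (r * d\<^sup>2) = r * (16 * (k * m) * d\<^sup>2)"
      by (simp only: mult_ac)
    ultimately have "16 * (k * m) * (r * d\<^sup>2) \<le> 16 * (k * m) * card Z"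
      by linarith
    moreover have "16 * (k * m) > 0" using assms by simp
    ultimately have "r * d\<^sup>2 \<le> card Z"
      by (metis mult_le_cancel1)
    \<comment> \<open>Under \<open>\<mu> S\<close> a vertex is false iff it is isolated in
      \<open>S\<close>, so no vertex forced by the rectangle is isolated.\<close>
    have "M e \<subseteq> {S. S \<subseteq> {..<n} \<and> (\<forall>z\<in>Z. S \<inter> N z \<noteq> {z})}"
    proof
      fix S
      assume "S \<in> M e"
      then have S: "S \<subseteq> {..<n}" "(\<lambda>v. \<mu> S (0, Suc v)) \<in> R"
        unfolding M_def R_def by auto
      have "\<mu> S (0, Suc z)" if "z \<in> Z" for z
      proof -
        have "\<forall>\<beta>\<in>R. \<beta> z"
          using that unfolding Z_def mem_Collect_eq by (rule conjunct2)
        from bspec[OF this S(2)] show ?thesis .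
      qed
      with S(1) show "S \<in> {S. S \<subseteq> {..<n} \<and> (\<forall>z\<in>Z. S \<inter> N z \<noteq> {z})}"
        by (simp add: \<mu>_def)
    qed
    then have "real (card (M e)) \<le> real (card {S. S \<subseteq> {..<n} \<and> (\<forall>z\<in>Z. S \<inter> N z \<noteq> {z})})"
      by (intro of_nat_mono card_mono) auto
    also have "\<dots> \<le> 2 ^ card {..<n} * (1 - 1 / 2 ^ d) ^ r"
    proof (rule card_no_isolated_bound)
      show "v \<in> N v \<and> N v \<subseteq> {..<n} \<and> card (N v) \<le> d" if "v \<in> {..<n}" for v
        using that card_circulant_nbhd[of m k v] unfolding N_def d n_def
        by (auto simp: circulant_nbhd_def)
      show "v \<in> N u" if "u \<in> {..<n}" "v \<in> {..<n}" "u \<in> N v" for u v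
        using that unfolding N_def n_def by (auto simp: circulant_nbhd_def)
      show "Z \<subseteq> {..<n}" unfolding Z_def by auto
      show "r * d\<^sup>2 \<le> card Z" by fact
    qed (simp_all add: d)
    finally show "real (card (M e)) \<le> 2 ^ n * (1 - 1 / 2 ^ d) ^ r" by simp
  qed
  also have "\<dots> = 2 ^ n * (real (card good) * (1 - 1 / 2 ^ d) ^ r)"
    by simp
  finally have "1 \<le> real (card good) * (1 - 1 / 2 ^ d) ^ r"
    by simp
  also have "\<dots> \<le> real (circuit_size C) * (1 - 1 / 2 ^ d) ^ r"
    unfolding circuit_size_def good_def
    by (intro mult_right_mono of_nat_mono card_mono finW) auto
  finally show ?thesis unfolding r_def n_def .
qed

section \<open>Asymptotics and choice of parameters\<close>

text \<open>The exponential function outgrows powers, and \<open>exp 1 \<le> 4\<close> turns it into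
  \<open>2 ^ (2 * m)\<close>.\<close>

lemma eventually_power_le_exp2: "eventually (\<lambda>m. k * m ^ k \<le> 2 ^ (2 * m)) (sequentially :: nat filter)"
proof -
  have "((\<lambda>x::real. x ^ k / exp x) \<longlongrightarrow> 0) at_top"
    by (rule tendsto_power_div_exp_0)
  then have "eventually (\<lambda>x::real. x ^ k / exp x < 1 / Suc k) at_top"
    by (rule order_tendstoD) simp
  then have "eventually (\<lambda>m. real m ^ k / exp (real m) < 1 / Suc k) sequentially"
    by (rule eventually_compose_filterlim[OF _ filterlim_real_sequentially])
  then show ?thesis
  proof eventually_elim
    case (elim m)
    then have "real m ^ k * Suc k \<le> exp (real m)"
      by (simp add: field_simps)
    also have "exp (real m) = exp 1 ^ m"
      by (simp flip: exp_of_nat_mult)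
    also have "\<dots> \<le> 4 ^ m"
      using exp_le by (intro power_mono) auto
    finally have "real (m ^ k * Suc k) \<le> real (4 ^ m)"
      by (simp add: algebra_simps)
    then have "m ^ k * Suc k \<le> 4 ^ m"
      by (simp only: of_nat_le_iff)
    then have "k * m ^ k \<le> 4 ^ m" by (simp add: mult.commute)
    then show ?case by (simp add: power_mult)
  qed
qed

text \<open>Both sides are compared with \<open>exp x\<close>, by
  \<open>1 - x \<le> exp (- x)\<close>. At \<open>x = 1 / 2 ^ d\<close> this converts the counting
  factor into a power of 2.\<close>

lemma two_powr_le_geometric:
  fixes x :: real
  assumes "0 \<le> x" "x < 1"
  shows "2 powr x \<le> 1 / (1 - x)"
proof -
  have "2 powr x \<le> exp x"
    using assms(1) ln_2_less_1 by (simp add: powr_def mult_left_le less_imp_le)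
  also have "1 - x \<le> exp (- x)"
    using exp_ge_add_one_self[of "- x"] by simp
  then have "exp x \<le> 1 / (1 - x)"
    using assms(2) by (simp add: exp_minus field_simps)
  finally show ?thesis .
qed

lemma gsize_circulant:
  assumes "m > 0" "k > 0"
  shows "m \<le> gsize (circulant_query a b m k) + gsize (circulant_instance a b m k)"
    and "gsize (circulant_query a b m k) + gsize (circulant_instance a b m k) \<le> 8 * k * m ^ Suc k"
proof -
  define n where "n = m ^ k"
  have size: "gsize (circulant_query a b m k) + gsize (circulant_instance a b m k)
      = k * n + n + 6 * (k * n * m)"
    by (simp add: circulant_query_def circulant_instance_def clause_query_def clause_instance_def
        gsize_parent_tree n_def algebra_simps)
  have "n > 0" using assms by (simp add: n_def)
  then have "m \<le> k * n * m" "k * n \<le> k * n * m" "n \<le> k * n"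
    using assms by simp_all
  moreover have "8 * k * m ^ Suc k = 8 * (k * n * m)"
    by (simp add: n_def mult_ac)
  ultimately show "m \<le> gsize (circulant_query a b m k) + gsize (circulant_instance a b m k)"
    and "gsize (circulant_query a b m k) + gsize (circulant_instance a b m k) \<le> 8 * k * m ^ Suc k"
    unfolding size by linarith+
qed

theorem proposition5p2:
  fixes \<sigma> :: "'l set" and \<epsilon> :: real
  assumes "signature \<sigma>" and "card \<sigma> \<ge> 2" and "\<epsilon> > 0"
  shows "\<exists>(G :: nat \<Rightarrow> (nat, 'l) lgraph) (H :: nat \<Rightarrow> (nat, 'l) lgraph).
    (\<forall>i>0. downward_tree \<sigma> (G i) \<and> downward_tree \<sigma> (H i)) \<and>
    (\<forall>N. \<exists>i>0. gsize (G i) + gsize (H i) \<ge> N) \<and>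
    (\<exists>c>0. \<forall>i>0. \<forall>C :: (nat, nat \<times> nat) circuit.
       DNNF_on (edges (H i)) C \<and> represents C (Prov (G i) (H i)) \<longrightarrow>
       real (circuit_size C) \<ge> 2 powr (c * real (gsize (G i) + gsize (H i)) powr (1 - \<epsilon>)))"
proof -
  obtain a b where ab: "a \<noteq> b" "{a, b} \<subseteq> \<sigma>"
    using assms(1,2) unfolding signature_def
    by (metis card_2_iff obtain_subset_with_card_n)
  \<comment> \<open>The size has order at most \<open>m ^ Suc k\<close>, the exponent of the bound
    order \<open>m ^ (k - 1)\<close>; hence \<open>\<delta> = 1 - 2 / Suc k\<close> must reach
    \<open>1 - \<epsilon>\<close>.\<close>
  obtain k0 :: nat where k0: "2 / \<epsilon> \<le> real k0"
    using real_arch_simple by blast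
  define k where "k = max 2 k0"
  have k: "k \<ge> 2" "2 / \<epsilon> \<le> real (Suc k)"
    using k0 unfolding k_def by auto
  define d where "d = 2 * k + 1"
  define A where "A = 16 * k * d\<^sup>2"
  define \<delta> where "\<delta> = real (k - 1) / real (Suc k)"
  have "2 / real (Suc k) \<le> \<epsilon>"
    using k(2) assms(3) by (simp add: field_simps)
  then have \<delta>: "1 - \<epsilon> \<le> \<delta>" "0 \<le> \<delta>" "\<delta> \<le> 1" "real (Suc k) * \<delta> = real (k - 1)"
    using k(1) unfolding \<delta>_def by (auto simp: of_nat_diff field_simps)
  obtain m0 where m0: "\<And>m. m \<ge> m0 \<Longrightarrow> k * m ^ k \<le> 2 ^ (2 * m)"
    using eventually_power_le_exp2 unfolding eventually_sequentially by blast
  \<comment> \<open>The offset makes the words long enough, and \<open>2 * A \<le> m i\<close>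
    limits the loss from rounding in the division by \<open>A\<close> to a factor 2.\<close>
  define m where "m = (\<lambda>i. i + m0 + 2 * A + 3)"
  have m: "m i \<ge> 3" "k * m i ^ k \<le> 2 ^ (2 * m i)" "2 * A \<le> m i" "i \<le> m i" for i
    using m0[of "m i"] unfolding m_def by auto
  define G where "G = (\<lambda>i. circulant_query a b (m i) k)"
  define H where "H = (\<lambda>i. circulant_instance a b (m i) k)"
  \<comment> \<open>The factors absorb, in this order, the change to base 2, the divisor in
    \<open>r\<close> with its rounding, and the constant in the size of the trees.\<close>
  define c where "c = 1 / (2 ^ d * (2 * real A) * (8 * real k))"
  have A: "A > 0" unfolding A_def d_def using k by simp
  have "c > 0"
    unfolding c_def using A k by simp
  have tree: "downward_tree \<sigma> (G i) \<and> downward_tree \<sigma> (H i)" for i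
    unfolding G_def H_def circulant_query_def circulant_instance_def
    using m(1)[of i] k ab(2) circulant_literal_less[of "m i"]
    by (intro conjI downward_tree_clause_query downward_tree_clause_instance) auto
  have bound: "2 powr (c * real (gsize (G i) + gsize (H i)) powr (1 - \<epsilon>)) \<le> real (circuit_size C)"
    if "DNNF_on (edges (H i)) C" "represents C (Prov (G i) (H i))"
    for i and C :: "(nat, nat \<times> nat) circuit"
  proof -
    define r where "r = m i ^ k div (16 * (k * m i) * d\<^sup>2)"
    define s where "s = gsize (G i) + gsize (H i)"
    have s: "m i \<le> s" "s \<le> 8 * k * m i ^ Suc k"
      using gsize_circulant[of "m i" k a b] m(1)[of i] k unfolding s_def G_def H_def by auto
    have "r = m i ^ (k - 1) div A"
    proof -
      have "m i ^ k = m i * m i ^ (k - 1)"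
        using k by (cases k) auto
      moreover have "16 * (k * m i) * d\<^sup>2 = m i * A"
        by (simp add: A_def mult_ac)
      ultimately show ?thesis
        unfolding r_def using m(1)[of i] by simp
    qed
    then have "m i ^ (k - 1) < A + A * r"
      using dividend_less_times_div[OF A, of "m i ^ (k - 1)"] by simp
    moreover have "m i ^ 1 \<le> m i ^ (k - 1)"
      using m(1)[of i] k by (intro power_increasing) auto
    with m(3)[of i] have "2 * A \<le> m i ^ (k - 1)" by simp
    ultimately have "m i ^ (k - 1) \<le> 2 * (A * r)" by linarith
    then have "real (m i ^ (k - 1)) \<le> real (2 * (A * r))"
      by (rule of_nat_mono)
    then have r: "real (m i ^ (k - 1)) / (2 * real A) \<le> real r"
      using A by (simp add: field_simps)
    \<comment> \<open>Passing to \<open>\<delta>\<close> uses \<open>s \<ge> 1\<close> and gives a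
      nonnegative exponent even for \<open>\<epsilon> > 1\<close>, as monotonicity in the base
      requires.\<close>
    have "real s powr (1 - \<epsilon>) \<le> real s powr \<delta>"
      using s(1) m(1)[of i] \<delta>(1) by (intro powr_mono) auto
    also have "\<dots> \<le> (8 * real k * real (m i) ^ Suc k) powr \<delta>"
    proof (rule powr_mono2)
      show "real s \<le> 8 * real k * real (m i) ^ Suc k"
        using of_nat_mono[OF s(2), where ?'a = real] by simp
    qed (use \<delta> in auto)
    also have "\<dots> = (8 * real k) powr \<delta> * (real (m i) powr real (Suc k)) powr \<delta>"
      using m(1)[of i] by (subst powr_realpow) (auto simp: powr_mult)
    also have "\<dots> = (8 * real k) powr \<delta> * real (m i) powr real (k - 1)"
      by (simp only: powr_powr \<delta>(4))
    also have "\<dots> = (8 * real k) powr \<delta> * real (m i ^ (k - 1))"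
      using m(1)[of i] by (subst powr_realpow) auto
    also have "\<dots> \<le> (8 * real k) powr 1 * real (m i ^ (k - 1))"
      using \<delta> k by (intro mult_right_mono powr_mono) auto
    finally have "real s powr (1 - \<epsilon>) \<le> 8 * real k * real (m i ^ (k - 1))"
      by simp
    then have "c * real s powr (1 - \<epsilon>) \<le> c * (8 * real k * real (m i ^ (k - 1)))"
      using \<open>c > 0\<close> by (intro mult_left_mono) auto
    also have "\<dots> = real (m i ^ (k - 1)) / (2 * real A) / 2 ^ d"
      unfolding c_def using k by simp
    also have "\<dots> \<le> real r / 2 ^ d"
      using r by (intro divide_right_mono) auto
    finally have exponent: "c * real s powr (1 - \<epsilon>) \<le> real r * (1 / 2 ^ d)" by simp
    define p :: real where "p = 1 - 1 / 2 ^ d"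
    have p: "0 < p" "2 powr (1 / 2 ^ d) \<le> 1 / p"
      using two_powr_le_geometric[of "1 / 2 ^ d"] one_less_power[of "2::real" d]
      unfolding p_def d_def by (simp_all add: field_simps)
    have "2 powr (c * real s powr (1 - \<epsilon>)) \<le> 2 powr (real r * (1 / 2 ^ d))"
      using exponent by (intro powr_mono) auto
    also have "\<dots> = (2 powr (1 / 2 ^ d)) ^ r"
      by (simp add: powr_power)
    also have "\<dots> \<le> (1 / p) ^ r"
      using p(2) by (intro power_mono) auto
    also have "\<dots> \<le> real (circuit_size C)"
    proof -
      have "1 \<le> real (circuit_size C) * p ^ r"
        unfolding p_def r_def using that ab(1) m k
        by (intro circulant_DNNF_size[of a b "m i" k d]) (auto simp: d_def G_def H_def)
      then show ?thesis
        using p(1) by (simp add: field_simps power_divide)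
    qed
    finally show ?thesis unfolding s_def .
  qed
  have unbounded: "\<exists>i>0. gsize (G i) + gsize (H i) \<ge> N" for N
  proof (intro exI[of _ "Suc N"] conjI)
    show "N \<le> gsize (G (Suc N)) + gsize (H (Suc N))"
      using gsize_circulant(1)[of "m (Suc N)" k a b] m[of "Suc N"] k unfolding G_def H_def by linarith
  qed simp
  show ?thesis
    using tree unbounded bound \<open>c > 0\<close> by blast
qed

end
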